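(* Let $(Z_t)_{t\in\mathbb Z}$ be i.i.d. real random variables with $\mathbb E Z_t=0$, $\mathbb E Z_t^2=1$. Let $a_j:[0,1]\to[0,\infty)$, $j\ge0$, be functions for which there are constants $0<\rho,Q,M<\infty$, $0<\nu<1$ and a positive sequence $(\ell(j))_{j\ge0}$ with $\sum_{j\ge1}j/\ell(j)<\infty$ such that $\inf_ua_0(u)>\rho$; $\sup_ua_j(u)\le Q/\ell(j)$ and $|a_j(u)-a_j(v)|\le M|u-v|/\ell(j)$ for all $j\ge0$ and all $u,v\in[0,1]$; and $Q\sum_{j\ge1}1/\ell(j)\le1-\nu$. Assume further that the third derivatives of the $a_j$ exist with $\sup_{u}|\partial^ia_j(u)/\partial u^i|\le C/\ell(j)$ for $i=1,2,3$, $j=0,1,\dots$, with a finite constant $C$ independent of $i$ and $j$. Let $\{X_{t,N}\}$ be the tvARCH($\infty$) process with coefficients $a_j$ and $\{\tilde X_t(u)\}$ the associated stationary ARCH($\infty$) process at $u$. Then for any $u_0\in(0,1]$, $$X_{t,N}^2=\tilde X_t(u_0)^2+\left(\frac tN-u_0\right)\left.\frac{\partial\tilde X_t(u)^2}{\partial u}\right|_{u=u_0}+\frac12\left(\frac tN-u_0\right)^2\left.\frac{\partial^2\tilde X_t(u)^2}{\partial u^2}\right|_{u=u_0}+O_p\left(\left|\frac tN-u_0\right|^3+\frac1N\right).$$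
   Context: The tvARCH($\infty$) process satisfies $X_{t,N}=\sigma_{t,N}Z_t$, $\sigma_{t,N}^2=a_0(t/N)+\sum_{j\ge1}a_j(t/N)X_{t-j,N}^2$ for $t=1,\dots,N$; with the convention $a_j(u)=0$ for $u<0$ and $j\ge0$, its square is the almost surely unique causal solution $X_{t,N}^2=a_0(\frac tN)Z_t^2+\sum_{k\ge1}\sum_{j_1,\dots,j_k\ge1}a_0(\frac{t-\sum_{s=1}^kj_s}{N})\prod_{r=1}^ka_{j_r}(\frac{t-\sum_{s=1}^{r-1}j_s}{N})\prod_{r=0}^kZ^2_{t-\sum_{s=1}^rj_s}$. The stationary process at $u$ satisfies $\tilde X_t(u)=\sigma_t(u)Z_t$, $\sigma_t(u)^2=a_0(u)+\sum_{j\ge1}a_j(u)\tilde X_{t-j}(u)^2$ for $t\in\mathbb Z$, and almost surely $\tilde X_t(u)^2=a_0(u)Z_t^2+\sum_{k\ge1}\sum_{j_1,\dots,j_k\ge1}a_0(u)\prod_{r=1}^ka_{j_r}(u)\prod_{r=0}^kZ^2_{t-\sum_{s=1}^rj_s}$. Derivatives in $u$ are derivatives of the sample functions $u\mapsto\tilde X_t(u)^2$ (one-sided at $u=1$). $O_p(c)$ denotes a remainder which divided by $c$ is bounded in probability. *)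

theory Defs
  imports "HOL-Probability.Probability"
begin

text \<open>
  The \<open>i\<close>-th derivative on the unit interval. Differentiating within \<open>{0..1}\<close> gives the
  two-sided derivative at interior points and the one-sided derivative at the end points.
\<close>

definition deriv01 :: "nat \<Rightarrow> (real \<Rightarrow> real) \<Rightarrow> real \<Rightarrow> real" where
  "deriv01 i = ((\<lambda>f u. vector_derivative f (at u within {0..1})) ^^ i)"

definition times_differentiable01 :: "nat \<Rightarrow> (real \<Rightarrow> real) \<Rightarrow> bool" where
  "times_differentiable01 n f \<longleftrightarrow> (\<forall>i<n. deriv01 i f differentiable_on {0..1})"

definition partial_lag :: "nat list \<Rightarrow> nat \<Rightarrow> int" where
  "partial_lag js r = int (sum_list (take r js))"

text \<open>
  The causal series solution along one sample path \<open>z\<close> of the innovations, where \<open>c j s\<close> is the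
  coefficient with lag \<open>j\<close> at time \<open>s\<close>. The list \<open>js\<close> holds the lags \<open>j\<^sub>1, \<dots>, j\<^sub>k\<close>, so that
  \<open>j\<^sub>r\<close> is \<open>js ! (r - 1)\<close>.
\<close>

definition causal_series :: "(nat \<Rightarrow> int \<Rightarrow> real) \<Rightarrow> (int \<Rightarrow> real) \<Rightarrow> int \<Rightarrow> real" where
  "causal_series c z t =
     c 0 t * (z t)\<^sup>2 +
     (\<Sum>\<^sub>\<infinity>k\<in>{1..}. \<Sum>\<^sub>\<infinity>js\<in>{js. length js = k \<and> (\<forall>j\<in>set js. 1 \<le> j)}.
        c 0 (t - partial_lag js k)
        * (\<Prod>r=1..k. c (js ! (r - 1)) (t - partial_lag js (r - 1)))
        * (\<Prod>r=0..k. (z (t - partial_lag js r))\<^sup>2))"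

definition extend_coeff :: "(nat \<Rightarrow> real \<Rightarrow> real) \<Rightarrow> nat \<Rightarrow> real \<Rightarrow> real" where
  "extend_coeff a j u = (if u < 0 then 0 else a j u)"

text \<open>
  Nothing is required of \<open>X t N\<close> outside \<open>1 \<le> t \<le> N\<close> beyond what the equations below impose on
  the pre-sample values.
\<close>

definition tvARCH ::
    "'w measure \<Rightarrow> (int \<Rightarrow> 'w \<Rightarrow> real) \<Rightarrow> (nat \<Rightarrow> real \<Rightarrow> real) \<Rightarrow> (int \<Rightarrow> nat \<Rightarrow> 'w \<Rightarrow> real) \<Rightarrow> bool"
  where
  "tvARCH M Z a X \<longleftrightarrow>
     (\<forall>t N. X t N \<in> borel_measurable M) \<and>
     (\<exists>\<sigma> :: int \<Rightarrow> nat \<Rightarrow> 'w \<Rightarrow> real.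
        (\<forall>t N. \<sigma> t N \<in> borel_measurable M) \<and>
        (\<forall>N. \<forall>t\<in>{1..int N}. AE \<omega> in M.
           X t N \<omega> = \<sigma> t N \<omega> * Z t \<omega> \<and>
           summable (\<lambda>i. a (Suc i) (real_of_int t / real N) * (X (t - int (Suc i)) N \<omega>)\<^sup>2) \<and>
           (\<sigma> t N \<omega>)\<^sup>2 = a 0 (real_of_int t / real N)
             + (\<Sum>i. a (Suc i) (real_of_int t / real N) * (X (t - int (Suc i)) N \<omega>)\<^sup>2))) \<and>
     (\<forall>N. \<forall>t\<in>{1..int N}. AE \<omega> in M.
        (X t N \<omega>)\<^sup>2 = causal_series (\<lambda>j s. extend_coeff a j (real_of_int s / real N)) (\<lambda>s. Z s \<omega>) t)"

text \<open>
  The exceptional null set of the series representation does not depend on \<open>u\<close>: otherwise the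
  sample functions could be modified at one point for each outcome, and their derivatives in \<open>u\<close>
  would be meaningless.
\<close>

definition stationary_ARCH ::
    "'w measure \<Rightarrow> (int \<Rightarrow> 'w \<Rightarrow> real) \<Rightarrow> (nat \<Rightarrow> real \<Rightarrow> real) \<Rightarrow> (int \<Rightarrow> real \<Rightarrow> 'w \<Rightarrow> real) \<Rightarrow> bool"
  where
  "stationary_ARCH M Z a X \<longleftrightarrow>
     (\<forall>t. \<forall>u\<in>{0..1}. X t u \<in> borel_measurable M) \<and>
     (\<exists>\<sigma> :: int \<Rightarrow> real \<Rightarrow> 'w \<Rightarrow> real.
        (\<forall>t. \<forall>u\<in>{0..1}. \<sigma> t u \<in> borel_measurable M) \<and>
        (\<forall>t. \<forall>u\<in>{0..1}. AE \<omega> in M.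
           X t u \<omega> = \<sigma> t u \<omega> * Z t \<omega> \<and>
           summable (\<lambda>i. a (Suc i) u * (X (t - int (Suc i)) u \<omega>)\<^sup>2) \<and>
           (\<sigma> t u \<omega>)\<^sup>2 = a 0 u + (\<Sum>i. a (Suc i) u * (X (t - int (Suc i)) u \<omega>)\<^sup>2))) \<and>
     (\<forall>t. AE \<omega> in M. \<forall>u\<in>{0..1}.
        (X t u \<omega>)\<^sup>2 = causal_series (\<lambda>j s. a j u) (\<lambda>s. Z s \<omega>) t)"

text \<open>
  \<open>R i = O\<^sub>p(c i)\<close>, uniformly over the index set \<open>I\<close>. The exceptional event is covered by a
  measurable set because \<open>measure\<close> is \<open>0\<close> on non-measurable sets, and sample derivatives need
  not be measurable when \<open>M\<close> is not complete.
\<close>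

definition bigo_in_prob :: "'w measure \<Rightarrow> 'i set \<Rightarrow> ('i \<Rightarrow> 'w \<Rightarrow> real) \<Rightarrow> ('i \<Rightarrow> real) \<Rightarrow> bool" where
  "bigo_in_prob M I R c \<longleftrightarrow>
     (\<forall>\<epsilon>>0. \<exists>K. \<forall>i\<in>I. \<exists>A\<in>sets M. measure M A \<le> \<epsilon> \<and>
        {\<omega>\<in>space M. \<bar>R i \<omega> / c i\<bar> > K} \<subseteq> A)"

end

theory Submission
  imports Defs
begin

text \<open>
  Write the causal series as one sum over all finite sequences \<open>js\<close> of positive lags. Each
  summand is a coefficient product times the noise product
  \<open>Z\<^sub>t\<^sup>2 Z\<^bsub>t - j\<^sub>1\<^esub>\<^sup>2 \<dots>\<close>. The times in a noise product are distinct, so by independence its mean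
  is \<open>1\<close> (\<open>expectation_path_noise\<close>). Every estimate is therefore made on the coefficient products,
  which are deterministic, and is then summed against the nonnegative noise.

  Three estimates are needed. Along a sequence of \<open>k\<close> lags with sum \<open>s\<close>, let \<open>B\<close> be the product of
  the bounds \<open>Q / l j\<close> of the factors. A derivative of order \<open>i \<le> 3\<close> of the coefficient product in
  \<open>u\<close> is at most \<open>((k + 1) D)\<^sup>i B\<close> with \<open>D = max 1 (C / Q)\<close>, by the Leibniz rule
  (\<open>path_deriv_bound\<close>). Replacing the
  coefficients at times \<open>t - j\<^sub>1 - \<dots> - j\<^sub>r\<close> by those at time \<open>t\<close> costs at most a multiple of
  \<open>(k + 1) s B / N\<close>, by the Lipschitz condition, as long as the path does not reach negative
  time. If it does, then \<open>s > t\<close> and the whole summand, at most \<open>B\<close>, is lost. Since \<open>u0 > 0\<close>, the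
  time \<open>t / N\<close> is either at distance at least \<open>u0 / 2\<close> from \<open>u0\<close>, so that the cubic term of the
  error is bounded below, or at least \<open>u0 / 2\<close>, so that \<open>1 < s / t \<le> 2 s / (u0 N)\<close>
  (\<open>early_time_bound\<close>). In all cases the error is at most a multiple of
  \<open>(\<bar>t / N - u0\<bar>\<^sup>3 + 1 / N) (k + 1) (1 + s) B\<close> (\<open>tv_path_coeff_diff\<close>).

  All these bounds are dominated by one summable weight on lag sequences
  (\<open>geometric_path_majorant\<close>), because \<open>\<Sum> Q / l j < 1\<close> and \<open>\<Sum> j / l j < \<infinity>\<close>. The sum of weight
  times noise has a finite mean that does not depend on \<open>t\<close>, and is in particular almost surely
  finite. On that event, Taylor's formula for each summand adds up to Taylor's formula for the
  whole series (\<open>dominated_series_Taylor\<close>); this gives both the differentiability of the sample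
  path and the second order expansion of the stationary process at \<open>u0\<close>. The total error,
  divided by \<open>\<bar>t / N - u0\<bar>\<^sup>3 + 1 / N\<close>, is at most a constant times that sum, and Markov's
  inequality makes it bounded in probability, uniformly in \<open>t\<close> and \<open>N\<close>.
\<close>

section \<open>Dominated series of real functions\<close>

lemma summable_on_dominated:
  fixes f g :: "'a \<Rightarrow> real"
  assumes "\<And>x. x \<in> A \<Longrightarrow> \<bar>f x\<bar> \<le> g x" "g summable_on A"
  shows "f summable_on A" "\<bar>infsum f A\<bar> \<le> infsum g A"
proof -
  have abs: "(\<lambda>x. \<bar>f x\<bar>) summable_on A"
    by (rule summable_on_comparison_test[OF assms(2)]) (use assms(1) in auto)
  then show f: "f summable_on A"
    using summable_on_iff_abs_summable_on_real[of f A] by simp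
  have "\<bar>infsum f A\<bar> \<le> infsum (\<lambda>x. \<bar>f x\<bar>) A"
    using norm_infsum_bound[of f A] abs by simp
  also have "\<dots> \<le> infsum g A"
    by (rule infsum_mono[OF abs assms(2)]) (use assms(1) in auto)
  finally show "\<bar>infsum f A\<bar> \<le> infsum g A" .
qed

text \<open>
  The passage from the random series in \<^typ>\<open>ennreal\<close>, where the order of summation and expectation
  can be exchanged without convergence assumptions, to real series along a single sample path.
\<close>

lemma summable_on_of_nn_integral_finite:
  fixes f :: "'a \<Rightarrow> real"
  assumes nonneg: "\<And>x. x \<in> A \<Longrightarrow> 0 \<le> f x"
    and fin: "(\<integral>\<^sup>+x. ennreal (f x) \<partial>count_space A) < \<infinity>"
  shows "f summable_on A"
    and "ennreal (infsum f A) \<le> (\<integral>\<^sup>+x. ennreal (f x) \<partial>count_space A)"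
proof -
  let ?I = "\<integral>\<^sup>+x. ennreal (f x) \<partial>count_space A"
  have part: "sum f F \<le> enn2real ?I" if F: "F \<subseteq> A" "finite F" for F
  proof -
    have "ennreal (sum f F) = (\<Sum>x\<in>F. ennreal (f x))"
      using F nonneg by (subst sum_ennreal) auto
    also have "\<dots> = (\<integral>\<^sup>+x. ennreal (f x) \<partial>count_space F)"
      using F by (simp add: nn_integral_count_space_finite)
    also have "\<dots> = (\<integral>\<^sup>+x. ennreal (f x) * indicator F x \<partial>count_space A)"
      using F by (auto simp: nn_integral_count_space_indicator intro!: nn_integral_cong
          split: split_indicator)
    also have "\<dots> \<le> ?I"
      by (intro nn_integral_mono) (auto simp: indicator_def)
    finally have le: "ennreal (sum f F) \<le> ?I" .
    show ?thesis
      using enn2real_mono[OF le] fin F nonneg by (simp add: sum_nonneg subset_iff)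
  qed
  show summ: "f summable_on A"
    using part nonneg by (intro nonneg_bdd_above_summable_on bdd_aboveI2) auto
  have "infsum f A \<le> enn2real ?I"
    using part by (intro infsum_le_finite_sums[OF summ]) auto
  then show "ennreal (infsum f A) \<le> ?I"
    using fin by (metis ennreal_enn2real ennreal_leI infinity_ennreal_def)
qed

lemma infsum_sum:
  fixes f :: "'i \<Rightarrow> 'a \<Rightarrow> real"
  assumes "finite I" "\<And>i. i \<in> I \<Longrightarrow> f i summable_on A"
  shows "(\<lambda>x. \<Sum>i\<in>I. f i x) summable_on A"
    and "infsum (\<lambda>x. \<Sum>i\<in>I. f i x) A = (\<Sum>i\<in>I. infsum (f i) A)"
proof -
  have "((\<lambda>x. \<Sum>i\<in>I. f i x) has_sum (\<Sum>i\<in>I. infsum (f i) A)) A"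
    using assms by (induction I rule: finite_induct) (auto intro!: has_sum_add)
  then show "(\<lambda>x. \<Sum>i\<in>I. f i x) summable_on A"
    and "infsum (\<lambda>x. \<Sum>i\<in>I. f i x) A = (\<Sum>i\<in>I. infsum (f i) A)"
    by (auto simp: summable_on_def dest: infsumI)
qed

lemma infsum_minus:
  fixes f g :: "'a \<Rightarrow> real"
  assumes "f summable_on A" "g summable_on A"
  shows "infsum (\<lambda>x. f x - g x) A = infsum f A - infsum g A"
  using infsum_add[of f A "\<lambda>x. - g x"] assms by (simp add: infsum_uminus summable_on_uminus)

text \<open>
  Taylor's formula holds for each function \<open>f x i\<close> with a remainder controlled by \<open>B x\<close>, and these
  remainders can be summed. Differentiability of the sum is the case \<open>p = 1\<close>.
\<close>

lemma dominated_series_Taylor: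
  fixes f :: "'a \<Rightarrow> nat \<Rightarrow> real \<Rightarrow> real"
  assumes S: "convex S" "u \<in> S" "v \<in> S"
    and deriv: "\<And>x i s. x \<in> A \<Longrightarrow> i < n \<Longrightarrow> s \<in> S \<Longrightarrow>
        (f x i has_real_derivative f x (Suc i) s) (at s within S)"
    and bound: "\<And>x i s. x \<in> A \<Longrightarrow> i \<le> n \<Longrightarrow> s \<in> S \<Longrightarrow> \<bar>f x i s\<bar> \<le> B x"
    and B: "B summable_on A"
    and ip: "i + Suc p \<le> n"
  shows "\<bar>(\<Sum>\<^sub>\<infinity>x\<in>A. f x i v) - (\<Sum>m\<le>p. (\<Sum>\<^sub>\<infinity>x\<in>A. f x (i + m) u) * (v - u) ^ m / fact m)\<bar>
      \<le> infsum B A * \<bar>v - u\<bar> ^ Suc p / fact p"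
proof -
  define c :: real where "c = \<bar>v - u\<bar> ^ Suc p / fact p"
  have summ: "(\<lambda>x. f x k s) summable_on A" if "k \<le> n" "s \<in> S" for k s
    by (rule summable_on_dominated(1)[OF bound B]) (use that in auto)
  have term_summ: "(\<lambda>x. f x (i + m) u * ((v - u) ^ m / fact m)) summable_on A" if "m \<le> p" for m
    using ip that by (intro summable_on_cmult_left summ S) auto
  have "infsum (\<lambda>x. \<Sum>m\<le>p. f x (i + m) u * ((v - u) ^ m / fact m)) A
      = (\<Sum>m\<le>p. infsum (\<lambda>x. f x (i + m) u * ((v - u) ^ m / fact m)) A)"
    by (rule infsum_sum(2)) (use term_summ in auto)
  also have "\<dots> = (\<Sum>m\<le>p. infsum (\<lambda>x. f x (i + m) u) A * ((v - u) ^ m / fact m))"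
    by (intro sum.cong refl infsum_cmult_left) (use ip summ S in auto)
  finally have "(\<Sum>\<^sub>\<infinity>x\<in>A. f x i v) - (\<Sum>m\<le>p. (\<Sum>\<^sub>\<infinity>x\<in>A. f x (i + m) u) * ((v - u) ^ m / fact m))
      = (\<Sum>\<^sub>\<infinity>x\<in>A. f x i v - (\<Sum>m\<le>p. f x (i + m) u * ((v - u) ^ m / fact m)))"
    using ip S infsum_minus[of "\<lambda>x. f x i v" A "\<lambda>x. \<Sum>m\<le>p. f x (i + m) u * ((v - u) ^ m / fact m)"]
      infsum_sum(1)[of "{..p}" "\<lambda>m x. f x (i + m) u * ((v - u) ^ m / fact m)" A] summ[of i v] term_summ
    by auto
  moreover have "\<bar>\<Sum>\<^sub>\<infinity>x\<in>A. f x i v - (\<Sum>m\<le>p. f x (i + m) u * ((v - u) ^ m / fact m))\<bar>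
      \<le> (\<Sum>\<^sub>\<infinity>x\<in>A. B x * c)"
  proof (rule summable_on_dominated(2))
    show "(\<lambda>x. B x * c) summable_on A" by (rule summable_on_cmult_left[OF B])
    fix x assume x: "x \<in> A"
    have "norm (f x (i + 0) v - (\<Sum>m\<le>p. f x (i + m) u * (v - u) ^ m / fact m))
        \<le> B x * norm (v - u) ^ Suc p / fact p"
      by (rule field_Taylor[where S = S and f = "\<lambda>m. f x (i + m)"])
        (use S x ip deriv[OF x] bound[OF x] in auto)
    then show "\<bar>f x i v - (\<Sum>m\<le>p. f x (i + m) u * ((v - u) ^ m / fact m))\<bar> \<le> B x * c"
      by (simp add: c_def)
  qed
  moreover have "(\<Sum>\<^sub>\<infinity>x\<in>A. B x * c) = infsum B A * c"
    by (rule infsum_cmult_left) (use B in auto)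
  ultimately show ?thesis by (simp add: c_def)
qed

lemma has_real_derivative_of_quadratic_remainder:
  fixes f :: "real \<Rightarrow> real"
  assumes "\<And>y. y \<in> S \<Longrightarrow> \<bar>f y - f x - f' * (y - x)\<bar> \<le> W * \<bar>y - x\<bar>\<^sup>2"
  shows "(f has_real_derivative f') (at x within S)"
  unfolding has_field_derivative_def has_derivative_within'
proof (intro conjI allI impI bounded_linear_mult_right)
  fix e :: real assume e: "0 < e"
  show "\<exists>d>0. \<forall>y\<in>S. 0 < norm (y - x) \<and> norm (y - x) < d \<longrightarrow>
      norm (f y - f x - f' * (y - x)) / norm (y - x) < e"
  \<comment> \<open>\<open>W\<close> may be zero, hence the summand \<open>1\<close>\<close>
  proof (intro exI[of _ "e / (\<bar>W\<bar> + 1)"] conjI ballI impI)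
    show "0 < e / (\<bar>W\<bar> + 1)" using e by simp
    fix y assume y: "y \<in> S" "0 < norm (y - x) \<and> norm (y - x) < e / (\<bar>W\<bar> + 1)"
    have "norm (f y - f x - f' * (y - x)) \<le> W * \<bar>y - x\<bar>\<^sup>2"
      using assms[OF y(1)] by simp
    also have "\<dots> \<le> ((\<bar>W\<bar> + 1) * \<bar>y - x\<bar>) * \<bar>y - x\<bar>"
    proof -
      have "W * \<bar>y - x\<bar> \<le> (\<bar>W\<bar> + 1) * \<bar>y - x\<bar>"
        by (rule mult_right_mono) auto
      from mult_right_mono[OF this abs_ge_zero[of "y - x"]] show ?thesis
        by (simp only: power2_eq_square mult.assoc)
    qed
    finally have "norm (f y - f x - f' * (y - x)) / norm (y - x) \<le> (\<bar>W\<bar> + 1) * \<bar>y - x\<bar>"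
      using y by (simp add: pos_divide_le_eq)
    also have "\<dots> < e" using y e by (simp add: field_simps)
    finally show "norm (f y - f x - f' * (y - x)) / norm (y - x) < e" .
  qed
qed

lemma dominated_series_has_derivative:
  fixes f :: "'a \<Rightarrow> nat \<Rightarrow> real \<Rightarrow> real"
  assumes S: "convex S" "u \<in> S"
    and deriv: "\<And>x i s. x \<in> A \<Longrightarrow> i < n \<Longrightarrow> s \<in> S \<Longrightarrow>
        (f x i has_real_derivative f x (Suc i) s) (at s within S)"
    and bound: "\<And>x i s. x \<in> A \<Longrightarrow> i \<le> n \<Longrightarrow> s \<in> S \<Longrightarrow> \<bar>f x i s\<bar> \<le> B x"
    and B: "B summable_on A"
    and i: "i + 2 \<le> n"
  shows "((\<lambda>v. \<Sum>\<^sub>\<infinity>x\<in>A. f x i v) has_real_derivative (\<Sum>\<^sub>\<infinity>x\<in>A. f x (Suc i) u)) (at u within S)"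
proof (rule has_real_derivative_of_quadratic_remainder)
  fix v assume "v \<in> S"
  then show "\<bar>(\<Sum>\<^sub>\<infinity>x\<in>A. f x i v) - (\<Sum>\<^sub>\<infinity>x\<in>A. f x i u) - (\<Sum>\<^sub>\<infinity>x\<in>A. f x (Suc i) u) * (v - u)\<bar>
      \<le> infsum B A * \<bar>v - u\<bar>\<^sup>2"
    using dominated_series_Taylor[where f = f and v = v and i = i and p = 1, OF S _ deriv bound B] i
    by (simp add: power2_eq_square algebra_simps)
qed

section \<open>Iterated derivatives on the unit interval\<close>

lemma times_differentiable01_has_derivative:
  assumes "times_differentiable01 n f" "i < n" "u \<in> {0..1}"
  shows "(deriv01 i f has_real_derivative deriv01 (Suc i) f u) (at u within {0..1})"
proof -
  have "deriv01 i f differentiable (at u within {0..1})"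
    using assms by (auto simp: times_differentiable01_def differentiable_on_def)
  then show ?thesis
    by (simp add: vector_derivative_works has_real_derivative_iff_has_vector_derivative deriv01_def)
qed

text \<open>
  The derivative within \<open>{0..1}\<close> is unique and depends only on the values on \<open>{0..1}\<close>. Hence
  \<^const>\<open>deriv01\<close> can be read off from any chain of functions in which each is the derivative
  of the one before.
\<close>

lemma deriv01_eqI:
  assumes F0: "\<And>u. u \<in> {0..1} \<Longrightarrow> f u = F 0 u"
    and F: "\<And>i u. i < n \<Longrightarrow> u \<in> {0..1} \<Longrightarrow> (F i has_real_derivative F (Suc i) u) (at u within {0..1})"
  shows "i \<le> n \<Longrightarrow> u \<in> {0..1} \<Longrightarrow> deriv01 i f u = F i u"
    and "times_differentiable01 n f"
proof -
  have step: "(g has_vector_derivative F (Suc i) u) (at u within {0..1})"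
    if "\<And>u. u \<in> {0..1} \<Longrightarrow> g u = F i u" "i < n" "u \<in> {0..1}" for g i u
    by (rule has_vector_derivative_transform[where f = "F i"])
      (use that F in \<open>auto simp: has_real_derivative_iff_has_vector_derivative\<close>)
  have eq: "\<forall>u\<in>{0..1}. deriv01 i f u = F i u" if "i \<le> n" for i
    using that
  proof (induction i)
    case 0
    with F0 show ?case by (simp add: deriv01_def)
  next
    case (Suc i)
    show ?case
    proof
      fix u :: real assume u: "u \<in> {0..1}"
      have "(deriv01 i f has_vector_derivative F (Suc i) u) (at u within {0..1})"
        using Suc u by (intro step) auto
      then have "vector_derivative (deriv01 i f) (at u within {0..1}) = F (Suc i) u"
        using u by (intro vector_derivative_within_closed_interval) auto
      then show "deriv01 (Suc i) f u = F (Suc i) u" by (simp add: deriv01_def)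
    qed
  qed
  then show "i \<le> n \<Longrightarrow> u \<in> {0..1} \<Longrightarrow> deriv01 i f u = F i u" by blast
  show "times_differentiable01 n f"
    unfolding times_differentiable01_def differentiable_on_def
    using eq step by (blast intro: differentiableI_vector less_imp_le)
qed

section \<open>A summable weight on lag sequences\<close>

text \<open>
  The lists of length \<open>k\<close> over a finite set \<open>F\<close> contribute \<open>(sum \<beta> F)\<^sup>k\<close>, so this is a geometric
  series. The induction uses the recursion \<open>S (n + 1) = 1 + sum \<beta> F * S n\<close> for the sum \<open>S n\<close> over the lists of
  length at most \<open>n\<close>, which preserves the bound \<open>1 / (1 - q)\<close>.
\<close>

lemma summable_prod_list:
  fixes \<beta> :: "'a \<Rightarrow> real"
  assumes nonneg: "\<And>j. j \<in> A \<Longrightarrow> 0 \<le> \<beta> j"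
    and sums: "\<And>F. finite F \<Longrightarrow> F \<subseteq> A \<Longrightarrow> sum \<beta> F \<le> q"
    and "q < 1"
  shows "(\<lambda>js. prod_list (map \<beta> js)) summable_on lists A"
proof (rule nonneg_bdd_above_summable_on)
  fix js assume "js \<in> lists A"
  then show "0 \<le> prod_list (map \<beta> js)"
    using nonneg by (auto intro!: prod_list_nonneg)
next
  have q: "0 \<le> q" using sums[of "{}"] by simp
  have words: "(\<Sum>js\<in>{js. set js \<subseteq> F \<and> length js \<le> n}. prod_list (map \<beta> js)) \<le> 1 / (1 - q)"
    if F: "finite F" "F \<subseteq> A" for F n
  proof (induction n)
    case 0
    have "{js. set js \<subseteq> F \<and> length js \<le> 0} = {[]}" by auto
    then show ?case using q \<open>q < 1\<close> by simp
  next
    case (Suc n)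
    let ?W = "\<lambda>n. {js. set js \<subseteq> F \<and> length js \<le> n}"
    let ?p = "\<lambda>js. prod_list (map \<beta> js)"
    have W: "?W (Suc n) = insert [] ((\<lambda>(j, js). j # js) ` (F \<times> ?W n))"
    proof (intro set_eqI)
      fix js show "js \<in> ?W (Suc n) \<longleftrightarrow> js \<in> insert [] ((\<lambda>(j, js). j # js) ` (F \<times> ?W n))"
        by (cases js) (auto simp: image_iff)
    qed
    have fin: "finite (?W n)" by (rule finite_lists_length_le[OF F(1)])
    have "sum ?p (?W (Suc n)) = 1 + sum ?p ((\<lambda>(j, js). j # js) ` (F \<times> ?W n))"
      unfolding W using fin F(1) by (subst sum.insert) auto
    also have "sum ?p ((\<lambda>(j, js). j # js) ` (F \<times> ?W n)) = (\<Sum>(j, js)\<in>F \<times> ?W n. \<beta> j * ?p js)"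
      by (subst sum.reindex) (auto simp: inj_on_def split_def)
    also have "\<dots> = sum \<beta> F * sum ?p (?W n)"
      by (simp add: sum_product sum.cartesian_product)
    also have "\<dots> \<le> q * (1 / (1 - q))"
      using F nonneg by (intro mult_mono sums Suc.IH q sum_nonneg prod_list_nonneg) auto
    also have "1 + q * (1 / (1 - q)) = 1 / (1 - q)"
      using \<open>q < 1\<close> by (simp add: field_simps)
    finally show ?case by simp
  qed
  show "bdd_above (sum (\<lambda>js. prod_list (map \<beta> js)) ` {G. G \<subseteq> lists A \<and> finite G})"
  proof (rule bdd_aboveI2)
    fix G assume "G \<in> {G. G \<subseteq> lists A \<and> finite G}"
    then have G: "G \<subseteq> lists A" "finite G" by auto
    define F where "F = (\<Union>js\<in>G. set js)"
    define n where "n = Max (insert 0 (length ` G))"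
    have F: "finite F" "F \<subseteq> A" using G by (auto simp: F_def lists_eq_set)
    have "G \<subseteq> {js. set js \<subseteq> F \<and> length js \<le> n}"
      using G by (auto simp: F_def n_def)
    then have "(\<Sum>js\<in>G. prod_list (map \<beta> js))
        \<le> (\<Sum>js\<in>{js. set js \<subseteq> F \<and> length js \<le> n}. prod_list (map \<beta> js))"
      using F nonneg by (intro sum_mono2 finite_lists_length_le prod_list_nonneg) auto
    also have "\<dots> \<le> 1 / (1 - q)" by (rule words[OF F])
    finally show "(\<Sum>js\<in>G. prod_list (map \<beta> js)) \<le> 1 / (1 - q)" .
  qed
qed

text \<open>
  If \<open>b j\<close> bounds the coefficient of lag \<open>j\<close>, then this bounds the summand of the causal series
  that belongs to the lags \<open>js\<close>, apart from the noise; the factor \<open>b 0\<close> comes from the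
  intercept.
\<close>

definition path_bound :: "(nat \<Rightarrow> real) \<Rightarrow> nat list \<Rightarrow> real" where
  "path_bound b js = b 0 * prod_list (map b js)"

lemma path_bound_simps [simp]:
  "path_bound b [] = b 0" "path_bound b (j # js) = b j * path_bound b js"
  by (simp_all add: path_bound_def)

lemma path_bound_nonneg: "(\<And>j. 0 \<le> b j) \<Longrightarrow> 0 \<le> path_bound b js"
  by (auto simp: path_bound_def intro!: prod_list_nonneg mult_nonneg_nonneg)

text \<open>
  The factors that are polynomial in the length and the sum of \<open>js\<close> can be absorbed in the
  product over the lags: by Bernoulli's inequality \<open>1 + \<eta> k \<le> (1 + \<eta>)\<^sup>k\<close>, and likewise
  \<open>1 + \<eta> (j\<^sub>1 + \<dots> + j\<^sub>k)\<close> is at most the product of the \<open>1 + \<eta> j\<^sub>r\<close>. The new weight of the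
  lag \<open>j\<close> is \<open>(1 + \<eta>)\<^sup>p (1 + \<eta> j) b j\<close>. Its sum tends to \<open>\<Sum> b j < 1\<close> as \<open>\<eta> \<rightarrow> 0\<close>, hence is
  below \<open>1\<close> for some \<open>\<eta> > 0\<close>.
\<close>

lemma geometric_path_majorant:
  fixes b :: "nat \<Rightarrow> real" and p :: nat
  assumes nonneg: "\<And>j. 0 \<le> b j"
    and summ: "summable (\<lambda>i. real (Suc i) * b (Suc i))"
    and less1: "(\<Sum>i. b (Suc i)) < 1"
  obtains \<beta> :: "nat \<Rightarrow> real" and K where "0 \<le> K" "\<And>j. 0 \<le> \<beta> j"
    "(\<lambda>js. prod_list (map \<beta> js)) summable_on lists {1..}"
    "\<And>js. real (Suc (length js)) ^ p * (1 + real (sum_list js)) * path_bound b js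
        \<le> K * prod_list (map \<beta> js)"
proof -
  define q where "q = (\<Sum>i. b (Suc i))"
  define \<Lambda> where "\<Lambda> = (\<Sum>i. real (Suc i) * b (Suc i))"
  have summ1: "summable (\<lambda>i. b (Suc i))"
  proof (rule summable_comparison_test'[OF summ])
    fix i :: nat
    show "norm (b (Suc i)) \<le> real (Suc i) * b (Suc i)"
      using mult_right_mono[of 1 "real (Suc i)" "b (Suc i)"] nonneg[of "Suc i"] by simp
  qed
  have "((\<lambda>\<eta>. (1 + \<eta>) ^ p * (q + \<eta> * \<Lambda>)) \<longlongrightarrow> (1 + 0) ^ p * (q + 0 * \<Lambda>)) (at_right 0)"
    by (intro tendsto_intros)
  then have "eventually (\<lambda>\<eta>. (1 + \<eta>) ^ p * (q + \<eta> * \<Lambda>) < 1) (at_right 0)"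
    using less1 by (intro order_tendstoD(2)) (auto simp: q_def)
  moreover have "eventually (\<lambda>\<eta>::real. \<eta> \<in> {0<..<1}) (at_right 0)"
    by (rule eventually_at_right_real) simp
  ultimately have "eventually (\<lambda>\<eta>. \<eta> \<in> {0<..<1} \<and> (1 + \<eta>) ^ p * (q + \<eta> * \<Lambda>) < 1) (at_right 0)"
    by eventually_elim simp
  then obtain \<eta> where \<eta>: "0 < \<eta>" "\<eta> < 1" "(1 + \<eta>) ^ p * (q + \<eta> * \<Lambda>) < 1"
    using eventually_happens[of _ "at_right (0::real)"] by auto
  \<comment> \<open>each lag pays for its own share of the polynomial factors\<close>
  define \<beta> where "\<beta> j = (1 + \<eta>) ^ p * (1 + \<eta> * real j) * b j" for j
  have \<beta>: "0 \<le> \<beta> j" for j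
    using \<eta> nonneg[of j] by (simp add: \<beta>_def)
  have sums: "(\<lambda>i. \<beta> (Suc i)) sums ((1 + \<eta>) ^ p * (q + \<eta> * \<Lambda>))"
  proof -
    have "(\<lambda>i. (1 + \<eta>) ^ p * (b (Suc i) + \<eta> * (real (Suc i) * b (Suc i)))) sums
        ((1 + \<eta>) ^ p * (q + \<eta> * \<Lambda>))"
      unfolding q_def \<Lambda>_def by (intro sums_mult sums_add summable_sums summ summ1)
    then show ?thesis by (simp add: \<beta>_def algebra_simps)
  qed
  have finsums: "sum \<beta> F \<le> (1 + \<eta>) ^ p * (q + \<eta> * \<Lambda>)" if F: "finite F" "F \<subseteq> {1..}" for F
  proof -
    have "sum \<beta> F = (\<Sum>i\<in>(\<lambda>j. j - 1) ` F. \<beta> (Suc i))"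
    proof (rule sum.reindex_bij_witness[of _ Suc "\<lambda>j. j - 1"])
      fix x assume "x \<in> F"
      with F show "Suc (x - 1) = x" "\<beta> (Suc (x - 1)) = \<beta> x" by auto
    next
      fix x assume "x \<in> (\<lambda>j. j - 1) ` F"
      with F show "Suc x \<in> F" by fastforce
    qed auto
    also have "\<dots> \<le> (\<Sum>i. \<beta> (Suc i))"
      using sums F \<beta> by (intro sum_le_suminf) (auto simp: sums_iff)
    finally show ?thesis using sums by (simp add: sums_iff)
  qed
  have base: "(1 + \<eta>) ^ (p * length js) * (1 + \<eta> * real (sum_list js)) * path_bound b js
      \<le> b 0 * prod_list (map \<beta> js)" for js
  proof (induction js)
    case Nil
    show ?case by simp
  next
    case (Cons j js)
    have 1: "(1 + \<eta> * real (sum_list (j # js))) \<le> (1 + \<eta> * real j) * (1 + \<eta> * real (sum_list js))"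
      using \<eta> by (simp add: algebra_simps)
    have "(1 + \<eta>) ^ (p * length (j # js)) * (1 + \<eta> * real (sum_list (j # js))) * path_bound b (j # js)
        \<le> (1 + \<eta>) ^ (p * length (j # js)) * ((1 + \<eta> * real j) * (1 + \<eta> * real (sum_list js)))
            * path_bound b (j # js)"
      using 1 \<eta> path_bound_nonneg[OF nonneg] nonneg
      by (intro mult_right_mono mult_left_mono) (auto intro!: mult_nonneg_nonneg)
    also have "\<dots> = \<beta> j * ((1 + \<eta>) ^ (p * length js) * (1 + \<eta> * real (sum_list js)) * path_bound b js)"
      by (simp add: \<beta>_def power_add)
    also have "\<dots> \<le> \<beta> j * (b 0 * prod_list (map \<beta> js))"
      by (rule mult_left_mono[OF Cons.IH \<beta>])
    finally show ?case by (simp add: ac_simps)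
  qed
  show thesis
  proof (rule that[of "(1 / \<eta>) ^ Suc p * b 0" \<beta>])
    show "0 \<le> (1 / \<eta>) ^ Suc p * b 0" using \<eta> nonneg[of 0] by simp
    show "(\<lambda>js. prod_list (map \<beta> js)) summable_on lists {1..}"
      by (rule summable_prod_list[OF \<beta> finsums \<eta>(3)]) 
    fix js :: "nat list"
    have "\<eta> * real (Suc (length js)) \<le> 1 + real (length js) * \<eta>"
      using \<eta> by (simp add: algebra_simps)
    also have "\<dots> \<le> (1 + \<eta>) ^ length js"
      using \<eta> by (intro Bernoulli_inequality) auto
    finally have 1: "real (Suc (length js)) \<le> 1 / \<eta> * (1 + \<eta>) ^ length js"
      using \<eta> by (simp add: field_simps)
    have "real (Suc (length js)) ^ p \<le> (1 / \<eta> * (1 + \<eta>) ^ length js) ^ p"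
      by (rule power_mono[OF 1]) simp
    also have "\<dots> = (1 / \<eta>) ^ p * (1 + \<eta>) ^ (p * length js)"
      by (simp add: power_mult_distrib power_mult[symmetric] mult.commute power_divide)
    finally have 2: "real (Suc (length js)) ^ p \<le> (1 / \<eta>) ^ p * (1 + \<eta>) ^ (p * length js)" .
    have 3: "1 + real (sum_list js) \<le> 1 / \<eta> * (1 + \<eta> * real (sum_list js))"
      using \<eta> by (simp add: field_simps)
    have "real (Suc (length js)) ^ p * (1 + real (sum_list js)) * path_bound b js
        \<le> ((1 / \<eta>) ^ p * (1 + \<eta>) ^ (p * length js)) * (1 / \<eta> * (1 + \<eta> * real (sum_list js)))
            * path_bound b js"
      using \<eta> by (intro mult_right_mono mult_mono 2 3 path_bound_nonneg nonneg) auto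
    also have "\<dots> = (1 / \<eta>) ^ Suc p * ((1 + \<eta>) ^ (p * length js) * (1 + \<eta> * real (sum_list js)) * path_bound b js)"
      by simp
    also have "\<dots> \<le> (1 / \<eta>) ^ Suc p * (b 0 * prod_list (map \<beta> js))"
      using \<eta> by (intro mult_left_mono base) auto
    finally show "real (Suc (length js)) ^ p * (1 + real (sum_list js)) * path_bound b js
        \<le> (1 / \<eta>) ^ Suc p * b 0 * prod_list (map \<beta> js)" by simp
  qed (rule \<beta>)
qed

section \<open>The causal series as a sum over lag sequences\<close>

text \<open>
  The coefficient and the noise of the summand with lags \<open>js\<close>, by recursion from the most recent
  time backwards: after the first lag \<open>j\<close> the remaining lags form a path that starts at \<open>t - j\<close>.
  In this form estimates go by induction over \<open>js\<close> with \<open>t\<close> arbitrary.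
\<close>

fun path_coeff :: "(nat \<Rightarrow> int \<Rightarrow> real) \<Rightarrow> int \<Rightarrow> nat list \<Rightarrow> real" where
  "path_coeff c t [] = c 0 t"
| "path_coeff c t (j # js) = c j t * path_coeff c (t - int j) js"

fun path_noise :: "(int \<Rightarrow> real) \<Rightarrow> int \<Rightarrow> nat list \<Rightarrow> real" where
  "path_noise z t [] = (z t)\<^sup>2"
| "path_noise z t (j # js) = (z t)\<^sup>2 * path_noise z (t - int j) js"

lemma path_noise_nonneg: "0 \<le> path_noise z t js"
  by (induction js arbitrary: t) auto

lemma partial_lag_0 [simp]: "partial_lag js 0 = 0"
  by (simp add: partial_lag_def)

lemma partial_lag_Cons [simp]: "partial_lag (j # js) (Suc r) = int j + partial_lag js r"
  by (simp add: partial_lag_def)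

lemma path_coeff_conv:
  "c 0 (t - partial_lag js (length js))
    * (\<Prod>r=1..length js. c (js ! (r - 1)) (t - partial_lag js (r - 1))) = path_coeff c t js"
proof (induction js arbitrary: t)
  case (Cons j js)
  have "(\<Prod>r=1..length (j # js). c ((j # js) ! (r - 1)) (t - partial_lag (j # js) (r - 1)))
      = c j t * (\<Prod>r<length js. c (js ! r) (t - int j - partial_lag js r))"
    unfolding One_nat_def prod.atLeast1_atMost_eq
    by (simp del: prod.lessThan_Suc add: prod.lessThan_Suc_shift algebra_simps)
  also have "(\<Prod>r<length js. c (js ! r) (t - int j - partial_lag js r))
      = (\<Prod>r=1..length js. c (js ! (r - 1)) (t - int j - partial_lag js (r - 1)))"
    unfolding One_nat_def prod.atLeast1_atMost_eq by simp
  finally show ?case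
    using Cons.IH[of "t - int j"] by (simp add: algebra_simps)
qed simp

lemma path_noise_conv:
  "(\<Prod>r=0..length js. (z (t - partial_lag js r))\<^sup>2) = path_noise z t js"
proof (induction js arbitrary: t)
  case (Cons j js)
  show ?case
    using Cons.IH[of "t - int j"]
    by (simp del: prod.atMost_Suc add: atLeast0AtMost prod.atMost_Suc_shift diff_diff_eq)
qed simp

text \<open>
  The lag sequences of length \<open>1, 2, \<dots>\<close> together with the empty one are all lists of positive
  numbers, and an absolutely convergent sum may be grouped by length.
\<close>

lemma causal_series_eq_infsum:
  assumes "(\<lambda>js. path_coeff c t js * path_noise z t js) summable_on lists {1..}"
  shows "causal_series c z t = (\<Sum>\<^sub>\<infinity>js\<in>lists {1..}. path_coeff c t js * path_noise z t js)"
proof -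
  let ?f = "\<lambda>js. path_coeff c t js * path_noise z t js"
  let ?L = "\<lambda>k. {js. length js = k \<and> (\<forall>j\<in>set js. 1 \<le> j)} :: nat list set"
  have lists: "lists {1..} = insert [] (snd ` Sigma {1..} ?L)"
  proof (intro set_eqI)
    fix js :: "nat list"
    show "js \<in> lists {1..} \<longleftrightarrow> js \<in> insert [] (snd ` Sigma {1..} ?L)"
      by (cases js) (auto simp: lists_eq_set image_iff)
  qed
  have nil: "[] \<notin> snd ` Sigma {1..} ?L" by auto
  have inj: "inj_on snd (Sigma {1..} ?L)" by (auto simp: inj_on_def)
  have summ: "?f summable_on (snd ` Sigma {1..} ?L)"
    by (rule summable_on_subset_banach[OF assms]) (use lists in auto)
  then have summ2: "(\<lambda>(k, js). ?f js) summable_on Sigma {1..} ?L"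
    using summable_on_reindex[OF inj, of ?f] by (simp add: o_def split_def)
  have "infsum ?f (lists {1..}) = ?f [] + infsum ?f (snd ` Sigma {1..} ?L)"
    unfolding lists by (rule infsum_insert[OF summ nil])
  also have "infsum ?f (snd ` Sigma {1..} ?L) = infsum (\<lambda>(k, js). ?f js) (Sigma {1..} ?L)"
    using infsum_reindex[OF inj, of ?f] by (simp add: o_def split_def)
  also have "\<dots> = (\<Sum>\<^sub>\<infinity>k\<in>{1..}. \<Sum>\<^sub>\<infinity>js\<in>?L k. ?f js)"
    using infsum_Sigma'_banach[OF summ2] by simp
  also have "?f [] + \<dots> = causal_series c z t"
    unfolding causal_series_def
    by (intro arg_cong2[where f = "(+)"] infsum_cong)
      (auto simp: path_coeff_conv[symmetric] path_noise_conv[symmetric])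
  finally show ?thesis by simp
qed

lemma path_coeff_bounds:
  assumes "\<And>j s. s \<le> t \<Longrightarrow> 0 \<le> c j s \<and> c j s \<le> b j"
  shows "0 \<le> path_coeff c t js \<and> path_coeff c t js \<le> path_bound b js"
  using assms
proof (induction js arbitrary: t)
  case (Cons j js)
  from Cons.IH[of "t - int j"] Cons.prems
  have "0 \<le> path_coeff c (t - int j) js \<and> path_coeff c (t - int j) js \<le> path_bound b js" by simp
  moreover have "0 \<le> c j t \<and> c j t \<le> b j" using Cons.prems by simp
  ultimately show ?case by (auto intro!: mult_mono)
qed auto

section \<open>Derivatives of coefficient products\<close>

lemma leibniz_sum_has_derivative:
  fixes f g :: "nat \<Rightarrow> real \<Rightarrow> real"
  assumes f: "\<And>m. m \<le> i \<Longrightarrow> (f m has_real_derivative f (Suc m) u) (at u within S)"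
    and g: "\<And>m. m \<le> i \<Longrightarrow> (g m has_real_derivative g (Suc m) u) (at u within S)"
  shows "((\<lambda>x. \<Sum>m\<le>i. real (i choose m) * f m x * g (i - m) x) has_real_derivative
      (\<Sum>m\<le>Suc i. real (Suc i choose m) * f m u * g (Suc i - m) u)) (at u within S)"
proof -
  have "((\<lambda>x. \<Sum>m\<le>i. real (i choose m) * (f m x * g (i - m) x)) has_real_derivative
      (\<Sum>m\<le>i. real (i choose m) * (f (Suc m) u * g (i - m) u + g (Suc (i - m)) u * f m u)))
      (at u within S)"
    by (intro DERIV_sum DERIV_cmult DERIV_mult f g) auto
  moreover have "(\<Sum>m\<le>i. real (i choose m) * (f (Suc m) u * g (i - m) u + g (Suc (i - m)) u * f m u))
      = (\<Sum>m\<le>Suc i. real (Suc i choose m) * f m u * g (Suc i - m) u)"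
  proof -
    have "(\<Sum>m\<le>Suc i. real (Suc i choose m) * f m u * g (Suc i - m) u)
        = (\<Sum>m\<le>i. real (i choose m) * f (Suc m) u * g (i - m) u)
          + (f 0 u * g (Suc i) u + (\<Sum>m\<le>i. real (i choose Suc m) * f (Suc m) u * g (i - m) u))"
      by (subst sum.atMost_Suc_shift) (simp add: sum.distrib algebra_simps)
    also have "f 0 u * g (Suc i) u + (\<Sum>m\<le>i. real (i choose Suc m) * f (Suc m) u * g (i - m) u)
        = (\<Sum>m\<le>Suc i. real (i choose m) * f m u * g (Suc i - m) u)"
      by (subst sum.atMost_Suc_shift) simp
    also have "\<dots> = (\<Sum>m\<le>i. real (i choose m) * f m u * g (Suc (i - m)) u)"
      by (simp add: Suc_diff_le)
    finally show ?thesis by (simp add: sum.distrib algebra_simps)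
  qed
  ultimately show ?thesis by (simp add: mult.assoc)
qed

text \<open>
  Derivatives of order \<open>i\<close> of the coefficient product along \<open>js\<close> in the common argument \<open>u\<close> of its
  factors, expanded by the Leibniz rule; \<open>d j i\<close> is the derivative of order \<open>i\<close> of the coefficient of lag \<open>j\<close>.
\<close>

fun path_deriv :: "(nat \<Rightarrow> nat \<Rightarrow> real \<Rightarrow> real) \<Rightarrow> nat list \<Rightarrow> nat \<Rightarrow> real \<Rightarrow> real" where
  "path_deriv d [] i u = d 0 i u"
| "path_deriv d (j # js) i u =
    (\<Sum>m\<le>i. real (i choose m) * d j m u * path_deriv d js (i - m) u)"

lemma path_deriv_has_derivative:
  assumes "\<And>j i. i < n \<Longrightarrow> (d j i has_real_derivative d j (Suc i) u) (at u within S)"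
  shows "i < n \<Longrightarrow> (path_deriv d js i has_real_derivative path_deriv d js (Suc i) u) (at u within S)"
proof (induction js arbitrary: i)
  case Nil
  have "path_deriv d [] k = d 0 k" for k by (rule ext) simp
  with assms Nil show ?case by simp
next
  case (Cons j js)
  have eq: "path_deriv d (j # js) k = (\<lambda>u. \<Sum>m\<le>k. real (k choose m) * d j m u * path_deriv d js (k - m) u)" for k
    by (rule ext) simp
  show ?case
    unfolding eq by (rule leibniz_sum_has_derivative) (use assms Cons in auto)
qed

text \<open>
  If the derivatives of each factor grow like \<open>D\<^sup>i\<close>, those of a product of \<open>n\<close> factors grow like
  \<open>(n D)\<^sup>i\<close>: by the Leibniz rule, multiplying functions with growth rates \<open>x\<close> and \<open>y\<close> gives the binomial
  expansion of \<open>(x + y)\<^sup>i\<close>.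
\<close>

lemma path_deriv_bound:
  assumes bd: "\<And>j i. i \<le> n \<Longrightarrow> \<bar>d j i u\<bar> \<le> D ^ i * b j" and "0 \<le> D"
  shows "i \<le> n \<Longrightarrow> \<bar>path_deriv d js i u\<bar> \<le> (real (Suc (length js)) * D) ^ i * path_bound b js"
proof (induction js arbitrary: i)
  case Nil
  with bd show ?case by simp
next
  case (Cons j js)
  have b: "0 \<le> b j" for j using bd[of 0 j] abs_ge_zero[of "d j 0 u"] by (simp del: abs_ge_zero)
  have "\<bar>path_deriv d (j # js) i u\<bar>
      \<le> (\<Sum>m\<le>i. \<bar>real (i choose m) * d j m u * path_deriv d js (i - m) u\<bar>)"
    by simp
  also have "\<dots> \<le> (\<Sum>m\<le>i. real (i choose m) * (D ^ m * b j)
      * ((real (Suc (length js)) * D) ^ (i - m) * path_bound b js))"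
    unfolding abs_mult using b \<open>0 \<le> D\<close> Cons.prems
    by (intro sum_mono mult_mono bd Cons.IH) auto
  also have "\<dots> = (\<Sum>m\<le>i. real (i choose m) * D ^ m * (real (Suc (length js)) * D) ^ (i - m))
      * (b j * path_bound b js)"
    unfolding sum_distrib_right by (intro sum.cong refl) (simp only: ac_simps)
  also have "\<dots> = (D + real (Suc (length js)) * D) ^ i * (b j * path_bound b js)"
    by (simp add: binomial_ring)
  also have "D + real (Suc (length js)) * D = real (Suc (length (j # js))) * D"
    by (simp add: algebra_simps)
  finally show ?case by simp
qed

lemma path_coeff_const: "path_coeff (\<lambda>j s. d j 0 u) t js = path_deriv d js 0 u"
  by (induction js arbitrary: t) auto

section \<open>Sample paths of the stationary process\<close>

text \<open>
  For a fixed realisation \<open>z\<close> of the noise, the sample path is a sum over lag sequences of smooth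
  functions of \<open>u\<close> whose derivatives up to order three have a common summable bound. This is
  one order more than the derivatives of the sample path that appear, since the third
  derivatives serve only in the remainders.
\<close>

lemma stationary_sample_path_smooth:
  fixes d :: "nat \<Rightarrow> nat \<Rightarrow> real \<Rightarrow> real" and g :: "real \<Rightarrow> real"
  assumes d: "\<And>j i u. i < 3 \<Longrightarrow> u \<in> {0..1} \<Longrightarrow>
        (d j i has_real_derivative d j (Suc i) u) (at u within {0..1})"
    and bound: "\<And>j i u. i \<le> 3 \<Longrightarrow> u \<in> {0..1} \<Longrightarrow> \<bar>d j i u\<bar> \<le> D ^ i * b j"
    and D: "1 \<le> D"
    and maj: "\<And>js. real (Suc (length js)) ^ 3 * path_bound b js \<le> m js"
    and summ: "(\<lambda>js. m js * path_noise z t js) summable_on lists {1..}"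
    and g: "\<And>u. u \<in> {0..1} \<Longrightarrow> g u = causal_series (\<lambda>j s. d j 0 u) z t"
  shows "times_differentiable01 2 g"
    and "u \<in> {0..1} \<Longrightarrow> v \<in> {0..1} \<Longrightarrow>
      \<bar>g v - (g u + (v - u) * deriv01 1 g u + 1 / 2 * (v - u)\<^sup>2 * deriv01 2 g u)\<bar>
        \<le> D ^ 3 * (\<Sum>\<^sub>\<infinity>js\<in>lists {1..}. m js * path_noise z t js) * \<bar>v - u\<bar> ^ 3"
proof -
  let ?P = "lists {1..} :: nat list set"
  define f where "f js i u = path_deriv d js i u * path_noise z t js" for js i u
  define B where "B js = D ^ 3 * (m js * path_noise z t js)" for js
  define F where "F i u = (\<Sum>\<^sub>\<infinity>js\<in>?P. f js i u)" for i u
  have b: "0 \<le> b j" for j using bound[of 0 0 j] abs_ge_zero[of "d j 0 0"] by (simp del: abs_ge_zero)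
  have B: "B summable_on ?P" unfolding B_def by (rule summable_on_cmult_right[OF summ])
  have f: "(f js i has_real_derivative f js (Suc i) s) (at s within {0..1})"
    if "i < 3" "s \<in> {0..1}" for js i s
    unfolding f_def by (intro DERIV_cmult_right path_deriv_has_derivative[where n = 3] d that)
  have fB: "\<bar>f js i s\<bar> \<le> B js" if "i \<le> 3" "s \<in> {0..1}" for js i s
  proof -
    have "\<bar>path_deriv d js i s\<bar> \<le> (real (Suc (length js)) * D) ^ i * path_bound b js"
      using that D by (intro path_deriv_bound[where n = 3] bound) auto
    also have "\<dots> \<le> (real (Suc (length js)) * D) ^ 3 * path_bound b js"
    proof (intro mult_right_mono power_increasing path_bound_nonneg b \<open>i \<le> 3\<close>)
      show "1 \<le> real (Suc (length js)) * D"
        using D mult_mono[of 1 "real (Suc (length js))" 1 D] by simp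
    qed
    also have "\<dots> = D ^ 3 * (real (Suc (length js)) ^ 3 * path_bound b js)"
      by (simp only: power_mult_distrib ac_simps)
    also have "\<dots> \<le> D ^ 3 * m js" using D by (intro mult_left_mono maj) auto
    finally have "\<bar>path_deriv d js i s\<bar> * path_noise z t js \<le> D ^ 3 * m js * path_noise z t js"
      by (rule mult_right_mono[OF _ path_noise_nonneg])
    then show ?thesis
      by (simp add: f_def B_def abs_mult abs_of_nonneg[OF path_noise_nonneg] mult.assoc)
  qed
  have gF: "g s = F 0 s" if s: "s \<in> {0..1}" for s
  proof -
    have "(\<lambda>js. f js 0 s) summable_on ?P"
      by (rule summable_on_dominated(1)[OF fB B]) (use s in auto)
    then have "causal_series (\<lambda>j r. d j 0 s) z t = F 0 s"
      using causal_series_eq_infsum[of "\<lambda>j r. d j 0 s" t z]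
      by (simp add: path_coeff_const F_def f_def)
    with g[OF s] show ?thesis by simp
  qed
  have FD: "(F i has_real_derivative F (Suc i) s) (at s within {0..1})" if "i < 2" "s \<in> {0..1}" for i s
    unfolding F_def
    by (rule dominated_series_has_derivative[where n = 3 and f = f, OF _ _ f fB B]) (use that in auto)
  show "times_differentiable01 2 g"
    using deriv01_eqI(2)[where F = F, OF gF FD] by simp
  assume u: "u \<in> {0..1}" and v: "v \<in> {0..1}"
  have der: "deriv01 i g u = F i u" if "i \<le> 2" for i
    using deriv01_eqI(1)[where F = F, OF gF FD that u] by simp
  have poly: "(\<Sum>i\<le>2. F (0 + i) u * (v - u) ^ i / fact i)
      = F 0 u + (v - u) * F 1 u + 1 / 2 * (v - u)\<^sup>2 * F 2 u"
    by (simp add: eval_nat_numeral ac_simps)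
  have "\<bar>F 0 v - (\<Sum>i\<le>2. F (0 + i) u * (v - u) ^ i / fact i)\<bar>
      \<le> infsum B ?P * \<bar>v - u\<bar> ^ Suc 2 / fact 2"
    unfolding F_def
    by (rule dominated_series_Taylor[where n = 3 and f = f, OF _ u v f fB B]) auto
  also have "\<dots> \<le> infsum B ?P * \<bar>v - u\<bar> ^ 3"
  proof -
    have "0 \<le> infsum B ?P"
      by (rule infsum_nonneg) (rule order_trans[OF abs_ge_zero fB[of 0 0]], auto)
    then have "0 \<le> infsum B ?P * \<bar>v - u\<bar> ^ 3" by simp
    then show ?thesis by simp
  qed
  also have "infsum B ?P = D ^ 3 * (\<Sum>\<^sub>\<infinity>js\<in>?P. m js * path_noise z t js)"
    unfolding B_def by (rule infsum_cmult_right) (use summ in auto)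
  finally show "\<bar>g v - (g u + (v - u) * deriv01 1 g u + 1 / 2 * (v - u)\<^sup>2 * deriv01 2 g u)\<bar>
        \<le> D ^ 3 * (\<Sum>\<^sub>\<infinity>js\<in>?P. m js * path_noise z t js) * \<bar>v - u\<bar> ^ 3"
    using der[of 1] der[of 2] gF[OF u] gF[OF v] by (simp only: poly)
qed

section \<open>Comparison of time-varying and constant coefficients\<close>

text \<open>
  The last time on a path is the earliest one. If it is negative, the intercept at that time, which
  is a factor of the product, vanishes.
\<close>

lemma path_coeff_eq_0:
  assumes "\<And>j s. s < 0 \<Longrightarrow> c j s = 0" "t < int (sum_list js)"
  shows "path_coeff c t js = 0"
  using assms(2) by (induction js arbitrary: t) (auto simp: assms(1))

text \<open>
  The factors are replaced one at a time. Each of them is evaluated at a time between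
  \<open>t - sum_list js\<close> and \<open>t\<close>, so that the Lipschitz condition costs at most \<open>T - t + sum_list js\<close>
  per factor. The reference time \<open>T\<close> stays fixed while the induction moves \<open>t\<close> back.
\<close>

lemma path_coeff_diff:
  assumes c: "\<And>j s. 0 \<le> s \<Longrightarrow> s \<le> T \<Longrightarrow> 0 \<le> c j s \<and> c j s \<le> b j"
    and d: "\<And>j. 0 \<le> d j \<and> d j \<le> b j"
    and cd: "\<And>j s. 0 \<le> s \<Longrightarrow> s \<le> T \<Longrightarrow> \<bar>c j s - d j\<bar> \<le> e * real_of_int (T - s) * b j"
    and e: "0 \<le> e"
  shows "t \<le> T \<Longrightarrow> int (sum_list js) \<le> t \<Longrightarrow>
    0 \<le> path_coeff c t js \<and> path_coeff c t js \<le> path_bound b js \<and>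
    \<bar>path_coeff c t js - path_coeff (\<lambda>j s. d j) t js\<bar>
      \<le> e * real (Suc (length js)) * real_of_int (T - t + int (sum_list js)) * path_bound b js"
proof (induction js arbitrary: t)
  case Nil
  with c cd show ?case by simp
next
  case (Cons j js)
  let ?P = "path_coeff c (t - int j) js" and ?P' = "path_coeff (\<lambda>j s. d j) (t - int j) js"
  let ?B = "path_bound b js" and ?m = "real_of_int (T - t + int (sum_list (j # js)))"
  have IH: "0 \<le> ?P" "?P \<le> ?B"
    "\<bar>?P - ?P'\<bar> \<le> e * real (Suc (length js)) * ?m * ?B"
    using Cons.IH[of "t - int j"] Cons.prems by (auto simp: algebra_simps)
  have t: "0 \<le> t" "t \<le> T" using Cons.prems by auto
  have m: "real_of_int (T - t) \<le> ?m" "0 \<le> ?m" using t by auto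
  have b: "0 \<le> b j" using d[of j] by auto
  have "\<bar>c j t * ?P - d j * ?P'\<bar> = \<bar>(c j t - d j) * ?P + d j * (?P - ?P')\<bar>"
    by (simp add: algebra_simps)
  also have "\<dots> \<le> \<bar>c j t - d j\<bar> * \<bar>?P\<bar> + \<bar>d j\<bar> * \<bar>?P - ?P'\<bar>"
    by (metis abs_mult abs_triangle_ineq)
  also have "\<dots> \<le> (e * ?m * b j) * ?B + b j * (e * real (Suc (length js)) * ?m * ?B)"
  proof (intro add_mono mult_mono)
    have "e * real_of_int (T - t) * b j \<le> e * ?m * b j"
      by (intro mult_right_mono mult_left_mono m e b)
    with cd[OF t, of j] show "\<bar>c j t - d j\<bar> \<le> e * ?m * b j" by linarith
  qed (use IH e m b d[of j] in auto)
  also have "\<dots> = e * real (Suc (length (j # js))) * ?m * path_bound b (j # js)"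
    by (simp add: algebra_simps)
  finally show ?case
    using c[OF t, of j] IH by (auto intro!: mult_mono)
qed

text \<open>
  This pays for the paths that reach negative time, where no Lipschitz estimate is available. If
  \<open>t / N \<ge> u0 / 2\<close>, then \<open>s > t\<close> is at least of the order of \<open>N\<close>, and the term \<open>s / N\<close> suffices. Otherwise
  \<open>t / N\<close> is far from \<open>u0\<close> and the cubic term suffices. The assumption \<open>u0 > 0\<close>
  cannot be dropped: for small \<open>t\<close> the time-varying process misses a part of the stationary one that is
  not small.
\<close>

lemma early_time_bound:
  fixes u0 :: real and t :: int and N s :: nat
  assumes t: "1 \<le> t" "t \<le> int N" and s: "t < int s" and u0: "0 < u0" "u0 \<le> 1"
  shows "1 \<le> (2 / u0) ^ 3 * (\<bar>real_of_int t / real N - u0\<bar> ^ 3 + 1 / real N) * (1 + real s)"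
proof -
  define x where "x = \<bar>real_of_int t / real N - u0\<bar>"
  have N: "0 < real N" using t by simp
  have x: "0 \<le> x" by (simp add: x_def)
  have "1 \<le> (2 / u0) ^ 3 * (x ^ 3 + 1 / real N) * (1 + real s)"
  proof (cases "u0 / 2 \<le> real_of_int t / real N")
    case True
    then have "u0 * real N \<le> 2 * real_of_int t" using N by (simp add: field_simps)
    also have "\<dots> \<le> 2 * real s" using s by linarith
    finally have "1 \<le> 2 / u0 * (1 / real N) * real s" using u0 N by (simp add: field_simps)
    \<comment> \<open>here \<open>u0 \<le> 1\<close> enters, through \<open>2 / u0 \<le> (2 / u0)\<^sup>3\<close>\<close>
    also have "\<dots> \<le> (2 / u0) ^ 3 * (x ^ 3 + 1 / real N) * (1 + real s)"
      using u0 x self_le_power[of "2 / u0" 3] by (intro mult_mono) auto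
    finally show ?thesis .
  next
    case False
    then have "u0 / 2 \<le> x" unfolding x_def by linarith
    then have "1 \<le> 2 / u0 * x" using u0 by (simp add: field_simps)
    then have "1 \<le> (2 / u0 * x) ^ 3" by (rule one_le_power)
    also have "\<dots> = (2 / u0) ^ 3 * x ^ 3 * 1" by (simp only: power_mult_distrib mult_1_right)
    also have "\<dots> \<le> (2 / u0) ^ 3 * (x ^ 3 + 1 / real N) * (1 + real s)"
      using u0 x by (intro mult_mono) auto
    finally show ?thesis .
  qed
  then show ?thesis by (simp only: x_def)
qed

lemma tv_path_coeff_diff:
  fixes a :: "nat \<Rightarrow> real \<Rightarrow> real" and b :: "nat \<Rightarrow> real" and \<Lambda> u0 :: real and t :: int and N :: nat
  assumes a: "\<And>j u. u \<in> {0..1} \<Longrightarrow> 0 \<le> a j u \<and> a j u \<le> b j"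
    and lip: "\<And>j u v. u \<in> {0..1} \<Longrightarrow> v \<in> {0..1} \<Longrightarrow> \<bar>a j u - a j v\<bar> \<le> \<Lambda> * \<bar>u - v\<bar> * b j"
    and \<Lambda>: "0 \<le> \<Lambda>" and t: "1 \<le> t" "t \<le> int N" and u0: "0 < u0" "u0 \<le> 1"
  defines "c \<equiv> \<lambda>j s. extend_coeff a j (real_of_int s / real N)"
    and "v \<equiv> real_of_int t / real N"
  shows "0 \<le> path_coeff c t js \<and> path_coeff c t js \<le> path_bound b js"
    and "\<bar>path_coeff c t js - path_coeff (\<lambda>j s. a j v) t js\<bar>
      \<le> (\<Lambda> + (2 / u0) ^ 3) * (\<bar>v - u0\<bar> ^ 3 + 1 / real N)
          * (real (Suc (length js)) * (1 + real (sum_list js)) * path_bound b js)"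
proof -
  have N: "0 < real N" using t by simp
  have v: "v \<in> {0..1}" using t N by (auto simp: v_def field_simps)
  have b: "0 \<le> b j" for j using a[of 0 j] by auto
  have c: "0 \<le> c j s \<and> c j s \<le> b j" if "s \<le> t" for j s
    using that a[of "real_of_int s / real N" j] b[of j] N t
    by (auto simp: c_def extend_coeff_def field_simps)
  show "0 \<le> path_coeff c t js \<and> path_coeff c t js \<le> path_bound b js"
    by (rule path_coeff_bounds) (rule c)
  define r where "r = \<bar>v - u0\<bar> ^ 3 + 1 / real N"
  define w where "w = real (Suc (length js)) * (1 + real (sum_list js)) * path_bound b js"
  have r: "0 \<le> r" "1 / real N \<le> r" by (auto simp: r_def)
  have w: "0 \<le> w" using path_bound_nonneg[OF b] by (simp add: w_def)
  have "\<bar>path_coeff c t js - path_coeff (\<lambda>j s. a j v) t js\<bar> \<le> (\<Lambda> + (2 / u0) ^ 3) * r * w"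
  proof (cases "int (sum_list js) \<le> t")
    case True
    have "\<bar>c j s - a j v\<bar> \<le> \<Lambda> / real N * real_of_int (t - s) * b j" if s: "0 \<le> s" "s \<le> t" for j s
    proof -
      have "real_of_int s / real N \<in> {0..1}" using s t N by (auto simp: field_simps)
      from lip[OF this v, of j]
      have "\<bar>c j s - a j v\<bar> \<le> \<Lambda> * \<bar>real_of_int s / real N - v\<bar> * b j"
        using divide_nonneg_pos[of "real_of_int s" "real N"] s N
        by (simp add: c_def extend_coeff_def not_less[symmetric])
      also have "\<bar>real_of_int s / real N - v\<bar> = real_of_int (t - s) / real N"
        using s N by (simp add: v_def diff_divide_distrib[symmetric] abs_divide)
      finally show ?thesis by simp
    qed
    then have "\<bar>path_coeff c t js - path_coeff (\<lambda>j s. a j v) t js\<bar>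
        \<le> \<Lambda> / real N * real (Suc (length js)) * real_of_int (t - t + int (sum_list js)) * path_bound b js"
      using path_coeff_diff[of t c b "\<lambda>j. a j v" "\<Lambda> / real N" t js] c a[OF v] \<Lambda> True by auto
    also have "\<dots> = \<Lambda> * (1 / real N) * (real (Suc (length js)) * real (sum_list js) * path_bound b js)"
      by simp
    also have "\<dots> \<le> (\<Lambda> + (2 / u0) ^ 3) * r * w"
      unfolding w_def using \<Lambda> u0 r path_bound_nonneg[OF b] by (intro mult_mono) auto
    finally show ?thesis .
  next
    case False
    have "\<bar>path_coeff c t js - path_coeff (\<lambda>j s. a j v) t js\<bar> = path_coeff (\<lambda>j s. a j v) t js"
      using path_coeff_eq_0[of c t js] path_coeff_bounds[of t "\<lambda>j s. a j v" b js] a[OF v] False N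
      by (simp add: c_def extend_coeff_def divide_neg_pos)
    also have "\<dots> \<le> 1 * 1 * path_bound b js"
      using path_coeff_bounds[of t "\<lambda>j s. a j v" b js] a[OF v] by simp
    also have "\<dots> \<le> ((2 / u0) ^ 3 * r * (1 + real (sum_list js))) * real (Suc (length js)) * path_bound b js"
      unfolding r_def v_def using early_time_bound[OF t _ u0, of "sum_list js"] False
      by (intro mult_right_mono mult_mono path_bound_nonneg b) auto
    also have "\<dots> = (2 / u0) ^ 3 * r * w" by (simp add: w_def)
    also have "\<dots> \<le> (\<Lambda> + (2 / u0) ^ 3) * r * w"
      using \<Lambda> r w by (intro mult_right_mono) auto
    finally show ?thesis .
  qed
  then show "\<bar>path_coeff c t js - path_coeff (\<lambda>j s. a j v) t js\<bar>
      \<le> (\<Lambda> + (2 / u0) ^ 3) * (\<bar>v - u0\<bar> ^ 3 + 1 / real N)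
          * (real (Suc (length js)) * (1 + real (sum_list js)) * path_bound b js)"
    by (simp only: r_def w_def)
qed

section \<open>The mean of the noise products\<close>

text \<open>
  The times at which the noise enters along a path. They are distinct because the lags are
  positive.
\<close>

fun path_times :: "int \<Rightarrow> nat list \<Rightarrow> int set" where
  "path_times t [] = {t}"
| "path_times t (j # js) = insert t (path_times (t - int j) js)"

lemma finite_path_times [simp]: "finite (path_times t js)"
  by (induction js arbitrary: t) auto

lemma path_times_le: "s \<in> path_times t js \<Longrightarrow> s \<le> t"
  by (induction js arbitrary: t) fastforce+

lemma path_noise_eq_prod:
  "js \<in> lists {1..} \<Longrightarrow> path_noise z t js = (\<Prod>s\<in>path_times t js. (z s)\<^sup>2)"
proof (induction js arbitrary: t)
  case (Cons j js)
  then have "t \<notin> path_times (t - int j) js" using path_times_le[of t "t - int j" js] by auto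
  with Cons show ?case by auto
qed simp

text \<open>
  The noise is a product of squares of independent variables with second moment \<open>1\<close>.
\<close>

lemma (in prob_space) expectation_path_noise:
  assumes indep: "indep_vars (\<lambda>_. borel) Z UNIV"
    and var: "\<And>t. expectation (\<lambda>\<omega>. (Z t \<omega>)\<^sup>2) = 1"
    and js: "js \<in> lists {1..}"
  shows "(\<integral>\<^sup>+\<omega>. ennreal (path_noise (\<lambda>s. Z s \<omega>) t js) \<partial>M) = 1"
proof -
  have int: "(\<integral>\<^sup>+\<omega>. ennreal ((Z s \<omega>)\<^sup>2) \<partial>M) = 1" for s
  proof -
    have "integrable M (\<lambda>\<omega>. (Z s \<omega>)\<^sup>2)"
      using var[of s] not_integrable_integral_eq[of M "\<lambda>\<omega>. (Z s \<omega>)\<^sup>2"] by fastforce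
    then show ?thesis using var[of s] by (subst nn_integral_eq_integral) auto
  qed
  have "(\<integral>\<^sup>+\<omega>. ennreal (path_noise (\<lambda>s. Z s \<omega>) t js) \<partial>M)
      = (\<integral>\<^sup>+\<omega>. (\<Prod>s\<in>path_times t js. ennreal ((Z s \<omega>)\<^sup>2)) \<partial>M)"
    by (simp add: path_noise_eq_prod[OF js] prod_ennreal)
  also have "\<dots> = (\<Prod>s\<in>path_times t js. \<integral>\<^sup>+\<omega>. ennreal ((Z s \<omega>)\<^sup>2) \<partial>M)"
  proof (rule indep_vars_nn_integral)
    show "indep_vars (\<lambda>_. borel) (\<lambda>s \<omega>. ennreal ((Z s \<omega>)\<^sup>2)) (path_times t js)"
      by (rule indep_vars_compose2[OF indep_vars_subset[OF indep]]) auto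
  qed auto
  also have "\<dots> = 1" by (simp add: int)
  finally show ?thesis .
qed

text \<open>
  By Tonelli's theorem the mean of \<open>H t\<close> is the sum of the weights \<open>m\<close>, whatever \<open>t\<close> is.
  The function \<open>H\<close> takes values in \<^typ>\<open>ennreal\<close>, so that it is defined and measurable everywhere.
\<close>

lemma (in prob_space) path_majorant_mean:
  fixes m :: "nat list \<Rightarrow> real"
  assumes indep: "indep_vars (\<lambda>_. borel) Z UNIV"
    and var: "\<And>t. expectation (\<lambda>\<omega>. (Z t \<omega>)\<^sup>2) = 1"
    and m: "\<And>js. 0 \<le> m js" "m summable_on lists {1..}"
  defines "H \<equiv> \<lambda>t \<omega>. \<integral>\<^sup>+js. ennreal (m js * path_noise (\<lambda>s. Z s \<omega>) t js) \<partial>count_space (lists {1..})"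
  obtains E where "\<And>t. H t \<in> borel_measurable M" "\<And>t. (\<integral>\<^sup>+\<omega>. H t \<omega> \<partial>M) = ennreal E"
    "\<And>t. AE \<omega> in M. H t \<omega> < \<infinity>"
proof -
  let ?P = "lists {1..} :: nat list set"
  have Z: "Z s \<in> borel_measurable M" for s
    using indep by (auto simp: indep_vars_def)
  have noise [measurable]: "(\<lambda>\<omega>. path_noise (\<lambda>s. Z s \<omega>) t js) \<in> borel_measurable M" for t js
    by (induction js arbitrary: t) (auto intro!: borel_measurable_times borel_measurable_power Z)
  have count: "countable ?P" by (rule countableI_type)
  interpret P: sigma_finite_measure "count_space ?P"
    by (rule sigma_finite_measure_count_space_countable[OF count])
  have meas: "H t \<in> borel_measurable M" for t
    unfolding H_def
  proof (rule P.borel_measurable_nn_integral)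
    have "(\<lambda>(js, \<omega>). ennreal (m js * path_noise (\<lambda>s. Z s \<omega>) t js))
        \<in> borel_measurable (count_space ?P \<Otimes>\<^sub>M M)"
      by (rule measurable_pair_measure_countable1[OF count]) simp
    from measurable_pair_swap[OF this]
    show "(\<lambda>(\<omega>, js). ennreal (m js * path_noise (\<lambda>s. Z s \<omega>) t js))
        \<in> borel_measurable (M \<Otimes>\<^sub>M count_space ?P)"
      by simp
  qed
  have "integrable (count_space ?P) m"
    using m abs_summable_equivalent[of m ?P] by (simp add: Infinite_Set_Sum.abs_summable_on_def)
  then have mean_m: "(\<integral>\<^sup>+js. ennreal (m js) \<partial>count_space ?P) = ennreal (\<integral>js. m js \<partial>count_space ?P)"
    by (rule nn_integral_eq_integral) (simp add: m)
  have mean: "(\<integral>\<^sup>+\<omega>. H t \<omega> \<partial>M) = ennreal (\<integral>js. m js \<partial>count_space ?P)" for t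
  proof -
    have "(\<integral>\<^sup>+\<omega>. H t \<omega> \<partial>M)
        = (\<integral>\<^sup>+js. \<integral>\<^sup>+\<omega>. ennreal (m js * path_noise (\<lambda>s. Z s \<omega>) t js) \<partial>M \<partial>count_space ?P)"
      unfolding H_def by (rule nn_integral_count_space_nn_integral[OF count]) simp
    also have "\<dots> = (\<integral>\<^sup>+js. ennreal (m js) \<partial>count_space ?P)"
    proof (rule nn_integral_cong)
      fix js assume "js \<in> space (count_space ?P)"
      then have js: "js \<in> ?P" by simp
      show "(\<integral>\<^sup>+\<omega>. ennreal (m js * path_noise (\<lambda>s. Z s \<omega>) t js) \<partial>M) = ennreal (m js)"
        using expectation_path_noise[OF indep var js, of t] m(1)
        by (simp add: ennreal_mult path_noise_nonneg nn_integral_cmult)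
    qed
    finally show ?thesis using mean_m by simp
  qed
  have "AE \<omega> in M. H t \<omega> < \<infinity>" for t
    using nn_integral_noteq_infinite[OF meas[of t]] mean[of t] by (simp add: top.not_eq_extremum)
  with meas mean show thesis by (rule that)
qed

section \<open>Boundedness in probability\<close>

text \<open>
  Markov's inequality for the measurable majorant \<open>V i\<close>. The remainder itself need not be
  measurable, so the event on which it is large is covered by one for \<open>V i\<close> and a null set.
\<close>

lemma (in prob_space) bigo_in_prob_of_bounded_mean:
  assumes meas: "\<And>i. i \<in> I \<Longrightarrow> V i \<in> borel_measurable M"
    and mean: "\<And>i. i \<in> I \<Longrightarrow> (\<integral>\<^sup>+\<omega>. V i \<omega> \<partial>M) \<le> ennreal E"
    and bound: "\<And>i. i \<in> I \<Longrightarrow> AE \<omega> in M. ennreal \<bar>R i \<omega> / c i\<bar> \<le> V i \<omega>"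
  shows "bigo_in_prob M I R c"
  unfolding bigo_in_prob_def
proof (intro allI impI)
  fix \<epsilon> :: real assume \<epsilon>: "0 < \<epsilon>"
  \<comment> \<open>\<open>\<bar>E\<bar> + 1\<close> instead of \<open>E\<close>, so that \<open>K\<close> is positive\<close>
  define K where "K = (\<bar>E\<bar> + 1) / \<epsilon>"
  have K: "0 < K" using \<epsilon> by (simp add: K_def)
  show "\<exists>K. \<forall>i\<in>I. \<exists>A\<in>sets M. measure M A \<le> \<epsilon> \<and> {\<omega>\<in>space M. K < \<bar>R i \<omega> / c i\<bar>} \<subseteq> A"
  proof (intro exI[of _ K] ballI)
    fix i assume i: "i \<in> I"
    note [measurable] = meas[OF i]
    from bound[OF i] obtain N where N: "{\<omega>\<in>space M. \<not> ennreal \<bar>R i \<omega> / c i\<bar> \<le> V i \<omega>} \<subseteq> N"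
      "emeasure M N = 0" "N \<in> sets M" by (rule AE_E)
    define B where "B = {\<omega>\<in>space M. 1 \<le> ennreal (1 / K) * V i \<omega>}"
    have B: "B \<in> sets M" unfolding B_def by measurable
    have "emeasure M B \<le> ennreal (1 / K) * (\<integral>\<^sup>+\<omega>. V i \<omega> * indicator (space M) \<omega> \<partial>M)"
      unfolding B_def by (rule nn_integral_Markov_inequality) auto
    also have "\<dots> = ennreal (1 / K) * (\<integral>\<^sup>+\<omega>. V i \<omega> \<partial>M)"
      by (intro arg_cong2[where f = "(*)"] nn_integral_cong) auto
    also have "\<dots> \<le> ennreal (1 / K) * ennreal (\<bar>E\<bar> + 1)"
      by (intro mult_left_mono order_trans[OF mean[OF i]] ennreal_leI) auto
    also have "\<dots> = ennreal \<epsilon>"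
      using \<epsilon> by (subst ennreal_mult[symmetric]) (auto simp: K_def)
    finally have "emeasure M (B \<union> N) \<le> ennreal \<epsilon>"
      using emeasure_subadditive[OF B N(3)] N(2) by simp
    then have "measure M (B \<union> N) \<le> \<epsilon>"
      using \<epsilon> by (simp add: emeasure_eq_measure)
    moreover have "{\<omega>\<in>space M. K < \<bar>R i \<omega> / c i\<bar>} \<subseteq> B \<union> N"
    proof
      fix \<omega> assume \<omega>: "\<omega> \<in> {\<omega>\<in>space M. K < \<bar>R i \<omega> / c i\<bar>}"
      show "\<omega> \<in> B \<union> N"
      proof (rule UnCI)
        assume "\<omega> \<notin> N"
        with N(1) \<omega> have "ennreal \<bar>R i \<omega> / c i\<bar> \<le> V i \<omega>" by auto
        moreover have "ennreal K \<le> ennreal \<bar>R i \<omega> / c i\<bar>"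
          using \<omega> by (intro ennreal_leI) simp
        ultimately have KV: "ennreal K \<le> V i \<omega>" by (rule order_trans[rotated])
        have "1 = ennreal (1 / K) * ennreal K"
          using K by (subst ennreal_mult[symmetric]) auto
        also have "\<dots> \<le> ennreal (1 / K) * V i \<omega>" by (rule mult_left_mono[OF KV]) simp
        finally show "\<omega> \<in> B" using \<omega> by (simp add: B_def)
      qed
    qed
    ultimately show "\<exists>A\<in>sets M. measure M A \<le> \<epsilon> \<and> {\<omega>\<in>space M. K < \<bar>R i \<omega> / c i\<bar>} \<subseteq> A"
      using B N(3) by blast
  qed
qed

section \<open>The second order expansion\<close>

theorem corollary2:
  fixes M :: "'w measure"
    and Z :: "int \<Rightarrow> 'w \<Rightarrow> real"
    and a :: "nat \<Rightarrow> real \<Rightarrow> real"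
    and l :: "nat \<Rightarrow> real"
    and \<rho> Q L \<nu> C u0 :: real
    and X :: "int \<Rightarrow> nat \<Rightarrow> 'w \<Rightarrow> real"
    and Xs :: "int \<Rightarrow> real \<Rightarrow> 'w \<Rightarrow> real"
  assumes "prob_space M"
    and "prob_space.indep_vars M (\<lambda>_. borel) Z UNIV"
    and "\<forall>s t. distr M borel (Z s) = distr M borel (Z t)"
    and "\<forall>t. prob_space.expectation M (Z t) = 0"
    and "\<forall>t. prob_space.expectation M (\<lambda>\<omega>. (Z t \<omega>)\<^sup>2) = 1"
    and "0 < \<rho>" "0 < Q" "0 < L" "0 < \<nu>" "\<nu> < 1"
    and "\<forall>j. 0 < l j"
    and "summable (\<lambda>i. real (Suc i) / l (Suc i))"
    and "\<forall>j. \<forall>u\<in>{0..1}. 0 \<le> a j u"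
    and "(INF u\<in>{0..1}. a 0 u) > \<rho>"
    and "\<forall>j. \<forall>u\<in>{0..1}. a j u \<le> Q / l j"
    and "\<forall>j. \<forall>u\<in>{0..1}. \<forall>v\<in>{0..1}. \<bar>a j u - a j v\<bar> \<le> L * \<bar>u - v\<bar> / l j"
    and "Q * (\<Sum>i. 1 / l (Suc i)) \<le> 1 - \<nu>"
    and "\<forall>j. times_differentiable01 3 (a j)"
    and "\<forall>j. \<forall>i\<in>{1..3}. \<forall>u\<in>{0..1}. \<bar>deriv01 i (a j) u\<bar> \<le> C / l j"
    and "tvARCH M Z a X"
    and "stationary_ARCH M Z a Xs"
    and "0 < u0" "u0 \<le> 1"
  shows "(\<forall>t. AE \<omega> in M. times_differentiable01 2 (\<lambda>u. (Xs t u \<omega>)\<^sup>2)) \<and>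
    bigo_in_prob M {(t :: int, N :: nat). 1 \<le> t \<and> t \<le> int N}
      (\<lambda>(t, N) \<omega>. (X t N \<omega>)\<^sup>2 -
         ((Xs t u0 \<omega>)\<^sup>2
          + (real_of_int t / real N - u0) * deriv01 1 (\<lambda>u. (Xs t u \<omega>)\<^sup>2) u0
          + 1 / 2 * (real_of_int t / real N - u0)\<^sup>2 * deriv01 2 (\<lambda>u. (Xs t u \<omega>)\<^sup>2) u0))
      (\<lambda>(t, N). \<bar>real_of_int t / real N - u0\<bar> ^ 3 + 1 / real N)"
proof -
  interpret prob_space M by fact
  let ?P = "lists {1..} :: nat list set"
  define b where "b j = Q / l j" for j
  \<comment> \<open>the maximum with \<open>1\<close> makes one constant serve for all orders up to three\<close>
  define D where "D = max 1 (C / Q)"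
  define d where "d j i = deriv01 i (a j)" for j i
  have b: "0 \<le> b j" for j using assms(7,11) by (simp add: b_def less_imp_le)
  have d0: "d j 0 = a j" for j by (simp add: d_def deriv01_def)
  have D: "1 \<le> D" by (simp add: D_def)
  have d_deriv: "(d j i has_real_derivative d j (Suc i) u) (at u within {0..1})"
    if "i < 3" "u \<in> {0..1}" for j i u
    unfolding d_def using assms(18) that by (intro times_differentiable01_has_derivative) auto
  have d_bound: "\<bar>d j i u\<bar> \<le> D ^ i * b j" if i: "i \<le> 3" and u: "u \<in> {0..1}" for j i u
  proof (cases "i = 0")
    case True
    then show ?thesis using assms(13,15) u by (simp add: d0 b_def)
  next
    case False
    then have "\<bar>d j i u\<bar> \<le> C / l j" using assms(19) i u by (simp add: d_def)
    also have "\<dots> = C / Q * b j" using assms(7) by (simp add: b_def)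
    also have "\<dots> \<le> D ^ i * b j"
      using self_le_power[OF D, of i] False b by (intro mult_right_mono) (auto simp: D_def)
    finally show ?thesis .
  qed
  have a_bound: "0 \<le> a j u \<and> a j u \<le> b j" if "u \<in> {0..1}" for j u
    using assms(13,15) that by (simp add: b_def)
  have a_lip: "\<bar>a j u - a j v\<bar> \<le> L / Q * \<bar>u - v\<bar> * b j" if "u \<in> {0..1}" "v \<in> {0..1}" for j u v
    using assms(7,16) that by (simp add: b_def)

  have b_summ: "summable (\<lambda>i. real (Suc i) * b (Suc i))"
    using summable_mult[OF assms(12), of Q] by (simp add: b_def mult.commute mult.left_commute)
  have b_less: "(\<Sum>i. b (Suc i)) < 1"
  proof -
    have "summable (\<lambda>i. 1 / l (Suc i))"
    proof (rule summable_comparison_test'[OF assms(12)])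
      fix i :: nat
      show "norm (1 / l (Suc i)) \<le> real (Suc i) / l (Suc i)"
        using assms(11)[rule_format, of "Suc i"] by (simp add: divide_right_mono)
    qed
    then have "(\<Sum>i. b (Suc i)) = Q * (\<Sum>i. 1 / l (Suc i))"
      using suminf_mult[of "\<lambda>i. 1 / l (Suc i)" Q] by (simp add: b_def)
    with assms(9,17) show ?thesis by simp
  qed
  obtain \<beta> :: "nat \<Rightarrow> real" and K where K: "0 \<le> K" and \<beta>: "\<And>j. 0 \<le> \<beta> j"
    and \<beta>_summ: "(\<lambda>js. prod_list (map \<beta> js)) summable_on ?P"
    and maj: "\<And>js. real (Suc (length js)) ^ 3 * (1 + real (sum_list js)) * path_bound b js
        \<le> K * prod_list (map \<beta> js)"
    by (rule geometric_path_majorant[OF b b_summ b_less, where p = 3]) (rule that)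
  define m where "m js = K * prod_list (map \<beta> js)" for js
  have m: "0 \<le> m js" for js
    using K \<beta> by (auto simp: m_def intro!: mult_nonneg_nonneg prod_list_nonneg)
  have m_summ: "m summable_on ?P"
    unfolding m_def by (rule summable_on_cmult_right[OF \<beta>_summ])
  have maj1: "real (Suc (length js)) ^ 3 * path_bound b js \<le> m js" for js
  proof -
    have "real (Suc (length js)) ^ 3 * 1 * path_bound b js
        \<le> real (Suc (length js)) ^ 3 * (1 + real (sum_list js)) * path_bound b js"
      by (intro mult_right_mono mult_left_mono path_bound_nonneg b) auto
    from order_trans[OF this maj] show ?thesis by (simp only: m_def mult_1_right)
  qed
  have maj2: "real (Suc (length js)) * (1 + real (sum_list js)) * path_bound b js \<le> m js" for js
  proof -
    have "real (Suc (length js)) \<le> real (Suc (length js)) ^ 3"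
      by (rule self_le_power) auto
    then have "real (Suc (length js)) * (1 + real (sum_list js)) * path_bound b js
        \<le> real (Suc (length js)) ^ 3 * (1 + real (sum_list js)) * path_bound b js"
      by (intro mult_right_mono path_bound_nonneg b) auto
    from order_trans[OF this maj] show ?thesis by (simp only: m_def)
  qed

  define noise where "noise t \<omega> js = path_noise (\<lambda>s. Z s \<omega>) t js" for t \<omega> js
  define H where "H t \<omega> = (\<integral>\<^sup>+js. ennreal (m js * noise t \<omega> js) \<partial>count_space ?P)" for t \<omega>
  obtain E where H_meas: "\<And>t. H t \<in> borel_measurable M"
    and H_mean: "\<And>t. (\<integral>\<^sup>+\<omega>. H t \<omega> \<partial>M) = ennreal E"
    and H_fin: "\<And>t. AE \<omega> in M. H t \<omega> < \<infinity>"
    using path_majorant_mean[OF assms(2) _ m m_summ] assms(5) unfolding H_def noise_def by blast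
  have noise: "0 \<le> noise t \<omega> js" for t \<omega> js by (simp add: noise_def path_noise_nonneg)
  have summ: "(\<lambda>js. m js * noise t \<omega> js) summable_on ?P"
    and H_ge: "ennreal (\<Sum>\<^sub>\<infinity>js\<in>?P. m js * noise t \<omega> js) \<le> H t \<omega>" if "H t \<omega> < \<infinity>" for t \<omega>
    using that summable_on_of_nn_integral_finite[of ?P "\<lambda>js. m js * noise t \<omega> js"] m noise
    by (auto simp: H_def)
  have Xs_series: "AE \<omega> in M. \<forall>u\<in>{0..1}. (Xs t u \<omega>)\<^sup>2 = causal_series (\<lambda>j s. d j 0 u) (\<lambda>s. Z s \<omega>) t" for t
    using assms(21) by (simp add: stationary_ARCH_def d0)
  have smooth: "times_differentiable01 2 (\<lambda>u. (Xs t u \<omega>)\<^sup>2)"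
    and Taylor: "\<And>u v. u \<in> {0..1} \<Longrightarrow> v \<in> {0..1} \<Longrightarrow>
      \<bar>(Xs t v \<omega>)\<^sup>2 - ((Xs t u \<omega>)\<^sup>2 + (v - u) * deriv01 1 (\<lambda>u. (Xs t u \<omega>)\<^sup>2) u
          + 1 / 2 * (v - u)\<^sup>2 * deriv01 2 (\<lambda>u. (Xs t u \<omega>)\<^sup>2) u)\<bar>
        \<le> D ^ 3 * (\<Sum>\<^sub>\<infinity>js\<in>?P. m js * noise t \<omega> js) * \<bar>v - u\<bar> ^ 3"
    if fin: "H t \<omega> < \<infinity>"
      and series: "\<forall>u\<in>{0..1}. (Xs t u \<omega>)\<^sup>2 = causal_series (\<lambda>j s. d j 0 u) (\<lambda>s. Z s \<omega>) t" for t \<omega>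
    using stationary_sample_path_smooth[where g = "\<lambda>u. (Xs t u \<omega>)\<^sup>2" and z = "\<lambda>s. Z s \<omega>",
        OF d_deriv d_bound D maj1 summ[OF fin, unfolded noise_def]] series
    by (simp_all add: noise_def)

  define K2 where "K2 = L / Q + (2 / u0) ^ 3 + D ^ 3"
  have K2: "0 \<le> K2" using assms(7,8,22) D by (simp add: K2_def)
  \<comment> \<open>The process at \<open>(t, N)\<close> is compared with the stationary process at \<open>v = t / N\<close>, which is then
      expanded at \<open>u0\<close>. The first error is at most \<open>(L / Q + (2 / u0)\<^sup>3) r h\<close>, the second one at
      most \<open>D\<^sup>3 r h\<close>, where \<open>r\<close> is the claimed order of the error and \<open>h\<close> the sum of weight
      times noise; this explains \<open>K2\<close>.\<close>
  have remainder: "ennreal \<bar>((X t N \<omega>)\<^sup>2 -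
         ((Xs t u0 \<omega>)\<^sup>2
          + (real_of_int t / real N - u0) * deriv01 1 (\<lambda>u. (Xs t u \<omega>)\<^sup>2) u0
          + 1 / 2 * (real_of_int t / real N - u0)\<^sup>2 * deriv01 2 (\<lambda>u. (Xs t u \<omega>)\<^sup>2) u0))
        / (\<bar>real_of_int t / real N - u0\<bar> ^ 3 + 1 / real N)\<bar> \<le> ennreal K2 * H t \<omega>"
    if t: "1 \<le> t" "t \<le> int N" and fin: "H t \<omega> < \<infinity>"
      and series: "\<forall>u\<in>{0..1}. (Xs t u \<omega>)\<^sup>2 = causal_series (\<lambda>j s. d j 0 u) (\<lambda>s. Z s \<omega>) t"
      and tv: "(X t N \<omega>)\<^sup>2 = causal_series (\<lambda>j s. extend_coeff a j (real_of_int s / real N)) (\<lambda>s. Z s \<omega>) t"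
    for t N \<omega>
  proof -
    define v where "v = real_of_int t / real N"
    define r where "r = \<bar>v - u0\<bar> ^ 3 + 1 / real N"
    define h where "h = (\<Sum>\<^sub>\<infinity>js\<in>?P. m js * noise t \<omega> js)"
    define c where "c j s = extend_coeff a j (real_of_int s / real N)" for j s
    let ?K1 = "L / Q + (2 / u0) ^ 3"
    have N: "0 < real N" using t by simp
    have v: "v \<in> {0..1}" using t N by (auto simp: v_def field_simps)
    have u0: "u0 \<in> {0..1}" using assms(22,23) by simp
    have r: "0 < r" "\<bar>v - u0\<bar> ^ 3 \<le> r" using N by (auto simp: r_def add_nonneg_pos)
    have K1: "0 \<le> ?K1" using assms(7,8,22) by simp
    have h: "0 \<le> h" unfolding h_def by (intro infsum_nonneg mult_nonneg_nonneg m noise)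
    note summ = summ[OF fin]
    have c_bound: "0 \<le> path_coeff c t js \<and> path_coeff c t js \<le> path_bound b js"
      and c_diff: "\<bar>path_coeff c t js - path_coeff (\<lambda>j s. a j v) t js\<bar>
        \<le> ?K1 * r * (real (Suc (length js)) * (1 + real (sum_list js)) * path_bound b js)" for js
      using tv_path_coeff_diff[of a b "L / Q" t N u0 js, OF a_bound a_lip _ t assms(22,23)] assms(7,8)
      by (auto simp: c_def[abs_def] v_def r_def)
    have PB_le: "path_bound b js \<le> m js" for js
    proof -
      have "1 * path_bound b js \<le> real (Suc (length js)) ^ 3 * path_bound b js"
        by (intro mult_right_mono path_bound_nonneg b one_le_power) auto
      with maj1[of js] show ?thesis by simp
    qed
    have dom: "\<bar>path_coeff e t js * noise t \<omega> js\<bar> \<le> m js * noise t \<omega> js"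
      if "0 \<le> path_coeff e t js \<and> path_coeff e t js \<le> path_bound b js" for e js
      using that PB_le[of js] noise[of t \<omega> js] by (auto simp: abs_mult intro!: mult_right_mono)
    have a_path: "0 \<le> path_coeff (\<lambda>j s. a j v) t js \<and> path_coeff (\<lambda>j s. a j v) t js \<le> path_bound b js" for js
      by (rule path_coeff_bounds) (use a_bound[OF v] in auto)
    note summ_c = summable_on_dominated(1)[OF dom[OF c_bound] summ]
    note summ_a = summable_on_dominated(1)[OF dom[OF a_path] summ]
    have X_eq: "(X t N \<omega>)\<^sup>2 = (\<Sum>\<^sub>\<infinity>js\<in>?P. path_coeff c t js * noise t \<omega> js)"
      using tv causal_series_eq_infsum[of c t "\<lambda>s. Z s \<omega>"] summ_c
      by (simp add: noise_def c_def[abs_def])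
    have Xs_eq: "(Xs t v \<omega>)\<^sup>2 = (\<Sum>\<^sub>\<infinity>js\<in>?P. path_coeff (\<lambda>j s. a j v) t js * noise t \<omega> js)"
      using series v causal_series_eq_infsum[of "\<lambda>j s. a j v" t "\<lambda>s. Z s \<omega>"] summ_a
      by (simp add: noise_def d0)
    have "(X t N \<omega>)\<^sup>2 - (Xs t v \<omega>)\<^sup>2
        = (\<Sum>\<^sub>\<infinity>js\<in>?P. path_coeff c t js * noise t \<omega> js - path_coeff (\<lambda>j s. a j v) t js * noise t \<omega> js)"
      unfolding X_eq Xs_eq by (rule infsum_minus[symmetric, OF summ_c summ_a])
    also have "\<bar>\<dots>\<bar> \<le> (\<Sum>\<^sub>\<infinity>js\<in>?P. ?K1 * r * (m js * noise t \<omega> js))"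
    proof (rule summable_on_dominated(2)[OF _ summable_on_cmult_right[OF summ]])
      fix js
      have "\<bar>path_coeff c t js - path_coeff (\<lambda>j s. a j v) t js\<bar> \<le> ?K1 * r * m js"
        using c_diff[of js] mult_left_mono[OF maj2[of js], of "?K1 * r"] K1 r by simp
      from mult_right_mono[OF this noise[of t \<omega> js]]
      show "\<bar>path_coeff c t js * noise t \<omega> js - path_coeff (\<lambda>j s. a j v) t js * noise t \<omega> js\<bar>
          \<le> ?K1 * r * (m js * noise t \<omega> js)"
        using abs_of_nonneg[OF noise[of t \<omega> js]]
        by (simp add: abs_mult left_diff_distrib[symmetric] mult.assoc)
    qed
    also have "\<dots> = ?K1 * r * h"
      unfolding h_def by (rule infsum_cmult_right) (use summ in auto)
    finally have tv_err: "\<bar>(X t N \<omega>)\<^sup>2 - (Xs t v \<omega>)\<^sup>2\<bar> \<le> ?K1 * r * h" .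
    define T where "T = (Xs t u0 \<omega>)\<^sup>2 + (v - u0) * deriv01 1 (\<lambda>u. (Xs t u \<omega>)\<^sup>2) u0
          + 1 / 2 * (v - u0)\<^sup>2 * deriv01 2 (\<lambda>u. (Xs t u \<omega>)\<^sup>2) u0"
    have "\<bar>(Xs t v \<omega>)\<^sup>2 - T\<bar> \<le> D ^ 3 * h * \<bar>v - u0\<bar> ^ 3"
      using Taylor[OF fin series u0 v] by (simp add: T_def h_def)
    also have "\<dots> \<le> D ^ 3 * h * r" using D h r by (intro mult_left_mono) auto
    finally have "\<bar>(X t N \<omega>)\<^sup>2 - T\<bar> \<le> ?K1 * r * h + D ^ 3 * h * r"
      using tv_err by linarith
    also have "\<dots> = K2 * h * r" by (simp add: K2_def algebra_simps)
    finally have "\<bar>((X t N \<omega>)\<^sup>2 - T) / r\<bar> \<le> K2 * h"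
      using r by (simp add: pos_divide_le_eq)
    then have "ennreal \<bar>((X t N \<omega>)\<^sup>2 - T) / r\<bar> \<le> ennreal K2 * ennreal h"
      using K2 h by (metis ennreal_leI ennreal_mult)
    also have "\<dots> \<le> ennreal K2 * H t \<omega>"
      using H_ge[OF fin] by (intro mult_left_mono) (auto simp: h_def)
    finally show ?thesis by (simp only: T_def r_def v_def)
  qed

  show ?thesis
  proof
    show "\<forall>t. AE \<omega> in M. times_differentiable01 2 (\<lambda>u. (Xs t u \<omega>)\<^sup>2)"
    proof
      fix t
      show "AE \<omega> in M. times_differentiable01 2 (\<lambda>u. (Xs t u \<omega>)\<^sup>2)"
        using H_fin[of t] Xs_series[of t] by eventually_elim (rule smooth)
    qed
    show "bigo_in_prob M {(t :: int, N :: nat). 1 \<le> t \<and> t \<le> int N}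
      (\<lambda>(t, N) \<omega>. (X t N \<omega>)\<^sup>2 -
         ((Xs t u0 \<omega>)\<^sup>2
          + (real_of_int t / real N - u0) * deriv01 1 (\<lambda>u. (Xs t u \<omega>)\<^sup>2) u0
          + 1 / 2 * (real_of_int t / real N - u0)\<^sup>2 * deriv01 2 (\<lambda>u. (Xs t u \<omega>)\<^sup>2) u0))
      (\<lambda>(t, N). \<bar>real_of_int t / real N - u0\<bar> ^ 3 + 1 / real N)"
    proof (rule bigo_in_prob_of_bounded_mean[where V = "\<lambda>(t, N) \<omega>. ennreal K2 * H t \<omega>" and E = "K2 * E"],
        goal_cases)
      case (1 i)
      then show ?case using H_meas by (auto split: prod.splits)
    next
      case (2 i)
      then show ?case
        using H_meas H_mean K2 by (auto simp: nn_integral_cmult ennreal_mult' split: prod.splits)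
    next
      case (3 i)
      obtain t N where i: "i = (t, N)" by (cases i)
      with 3 have t: "1 \<le> t" "t \<le> int N" by auto
      have "AE \<omega> in M. (X t N \<omega>)\<^sup>2
          = causal_series (\<lambda>j s. extend_coeff a j (real_of_int s / real N)) (\<lambda>s. Z s \<omega>) t"
        using assms(20) t by (simp add: tvARCH_def)
      with H_fin[of t] Xs_series[of t] show ?case
        unfolding i prod.case by eventually_elim (rule remainder[OF t])
    qed
  qed
qed

end
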